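(* Let $G$ be a directed co-graph, or an extended directed co-graph given by an ex-di-co-tree. Then an optimal acyclic coloring of $G$ (i.e. an acyclic $\vec{\chi}(G)$-coloring) and the dichromatic number $\vec{\chi}(G)$ can be computed in linear time.
   Context: For a digraph $G=(V,E)$, a set $V'\subseteq V$ is acyclic if $G[V']$ has no directed cycle; an acyclic $r$-coloring is a map $c:V\to\{1,\dots,r\}$ whose color classes are all acyclic, and $\vec{\chi}(G)$ is the least such $r$. For vertex-disjoint digraphs $G_1=(V_1,E_1)$, $G_2=(V_2,E_2)$: the disjoint union $G_1\oplus G_2$ has vertex set $V_1\cup V_2$ and arc set $E_1\cup E_2$; the series composition $G_1\otimes G_2$ is the disjoint union plus all arcs in both directions between $V_1$ and $V_2$; the order composition $G_1\oslash G_2$ is the disjoint union plus all arcs from $V_1$ to $V_2$; a directed union $G_1\ominus G_2$ is any digraph that is a subdigraph of $G_1\oslash G_2$ and contains $G_1\oplus G_2$ as a subdigraph. Directed co-graphs are the digraphs obtained from single-vertex digraphs by repeatedly applying disjoint union, series composition and order composition. Extended directed co-graphs are the digraphs obtained from single-vertex digraphs by repeatedly applying directed union and series composition. An ex-di-co-tree of an extended directed co-graph is a rooted tree whose leaves are the vertices of the digraph and whose inner nodes correspond to the operations (with their operands being the digraphs defined by the child subtrees) used to build it. *)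

theory Defs
  imports "Graph_Theory.Digraph_Component"
begin

section \<open>Acyclic colorings\<close>

text \<open>
  Digraphs without parallel arcs are the library's pairs of a vertex set and an arc relation.
  The library's cycles include those of length two, so a pair of opposite arcs is a directed cycle.
\<close>

definition acyclic_set :: "'a pair_pre_digraph \<Rightarrow> 'a set \<Rightarrow> bool" where
  "acyclic_set G S \<longleftrightarrow> S \<subseteq> pverts G \<and> \<not> (\<exists>p. pre_digraph.cycle (with_proj G \<restriction> S) p)"

definition acyclic_coloring :: "'a pair_pre_digraph \<Rightarrow> nat \<Rightarrow> ('a \<Rightarrow> nat) \<Rightarrow> bool" where
  "acyclic_coloring G r c \<longleftrightarrow>
     c ` pverts G \<subseteq> {1..r} \<and> (\<forall>i\<in>{1..r}. acyclic_set G {v \<in> pverts G. c v = i})"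

definition dichromatic_number :: "'a pair_pre_digraph \<Rightarrow> nat" where
  "dichromatic_number G = (LEAST r. \<exists>c. acyclic_coloring G r c)"

section \<open>Directed co-graphs and extended directed co-graphs\<close>

definition single_vertex :: "'a \<Rightarrow> 'a pair_pre_digraph" where
  "single_vertex v = \<lparr>pverts = {v}, parcs = {}\<rparr>"

definition disjoint_union ::
    "'a pair_pre_digraph \<Rightarrow> 'a pair_pre_digraph \<Rightarrow> 'a pair_pre_digraph" where
  "disjoint_union G H = \<lparr>pverts = pverts G \<union> pverts H, parcs = parcs G \<union> parcs H\<rparr>"

definition series_composition ::
    "'a pair_pre_digraph \<Rightarrow> 'a pair_pre_digraph \<Rightarrow> 'a pair_pre_digraph" where
  "series_composition G H =
     \<lparr>pverts = pverts G \<union> pverts H,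
      parcs = parcs G \<union> parcs H \<union> pverts G \<times> pverts H \<union> pverts H \<times> pverts G\<rparr>"

definition order_composition ::
    "'a pair_pre_digraph \<Rightarrow> 'a pair_pre_digraph \<Rightarrow> 'a pair_pre_digraph" where
  "order_composition G H =
     \<lparr>pverts = pverts G \<union> pverts H,
      parcs = parcs G \<union> parcs H \<union> pverts G \<times> pverts H\<rparr>"

text \<open>The directed union is not an operation: it relates two digraphs to each admissible result.\<close>

definition is_directed_union ::
    "'a pair_pre_digraph \<Rightarrow> 'a pair_pre_digraph \<Rightarrow> 'a pair_pre_digraph \<Rightarrow> bool" where
  "is_directed_union G H D \<longleftrightarrow>
     subgraph (with_proj D) (with_proj (order_composition G H)) \<and>
     subgraph (with_proj (disjoint_union G H)) (with_proj D)"

inductive directed_cograph :: "'a pair_pre_digraph \<Rightarrow> bool" where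
  single: "directed_cograph (single_vertex v)"
| union: "\<lbrakk>directed_cograph G; directed_cograph H; pverts G \<inter> pverts H = {}\<rbrakk>
    \<Longrightarrow> directed_cograph (disjoint_union G H)"
| series: "\<lbrakk>directed_cograph G; directed_cograph H; pverts G \<inter> pverts H = {}\<rbrakk>
    \<Longrightarrow> directed_cograph (series_composition G H)"
| order: "\<lbrakk>directed_cograph G; directed_cograph H; pverts G \<inter> pverts H = {}\<rbrakk>
    \<Longrightarrow> directed_cograph (order_composition G H)"

inductive ext_directed_cograph :: "'a pair_pre_digraph \<Rightarrow> bool" where
  single: "ext_directed_cograph (single_vertex v)"
| dunion: "\<lbrakk>ext_directed_cograph G; ext_directed_cograph H; pverts G \<inter> pverts H = {};
     is_directed_union G H D\<rbrakk> \<Longrightarrow> ext_directed_cograph D"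
| series: "\<lbrakk>ext_directed_cograph G; ext_directed_cograph H; pverts G \<inter> pverts H = {}\<rbrakk>
    \<Longrightarrow> ext_directed_cograph (series_composition G H)"

datatype 'a cotree = Leaf 'a | DUnion "'a cotree" "'a cotree" | Series "'a cotree" "'a cotree"

text \<open>
  One tree is an ex-di-co-tree of several digraphs in general, as a node for a directed union
  does not record which arcs between its two operands are present.
\<close>

inductive ex_di_cotree :: "'a cotree \<Rightarrow> 'a pair_pre_digraph \<Rightarrow> bool" where
  leaf: "ex_di_cotree (Leaf v) (single_vertex v)"
| dunion: "\<lbrakk>ex_di_cotree S G; ex_di_cotree T H; pverts G \<inter> pverts H = {};
     is_directed_union G H D\<rbrakk> \<Longrightarrow> ex_di_cotree (DUnion S T) D"
| series: "\<lbrakk>ex_di_cotree S G; ex_di_cotree T H; pverts G \<inter> pverts H = {}\<rbrakk>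
    \<Longrightarrow> ex_di_cotree (Series S T) (series_composition G H)"

lemma ext_directed_cograph_iff_cotree: "ext_directed_cograph G \<longleftrightarrow> (\<exists>T. ex_di_cotree T G)"
proof
  show "ext_directed_cograph G \<Longrightarrow> \<exists>T. ex_di_cotree T G"
    by (induction rule: ext_directed_cograph.induct) (blast intro: ex_di_cotree.intros)+
next
  have "ext_directed_cograph G" if "ex_di_cotree T G" for T
    using that by induction (blast intro: ext_directed_cograph.intros)+
  then show "\<exists>T. ex_di_cotree T G \<Longrightarrow> ext_directed_cograph G"
    by blast
qed

section \<open>Random access machines\<close>

text \<open>
  Programs of a random access machine, with structured control flow. A program mentions finitely
  many registers; the memory cells are addressed by register contents.
\<close>

datatype test = Less nat nat | Equal nat nat

datatype com =
    Skip
  | Const nat nat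
  | Copy nat nat
  | Add nat nat nat
  | Sub nat nat nat
  | Load nat nat
  | Store nat nat
  | Seq com com
  | If test com com
  | While test com

type_synonym state = "(nat \<Rightarrow> nat) \<times> (nat \<Rightarrow> nat)"

fun holds :: "test \<Rightarrow> state \<Rightarrow> bool" where
  "holds (Less i j) (r, m) \<longleftrightarrow> r i < r j"
| "holds (Equal i j) (r, m) \<longleftrightarrow> r i = r j"

text \<open>
  \<open>exec B P s t s'\<close>: started in \<open>s\<close>, the program \<open>P\<close> halts in \<open>s'\<close> after \<open>t\<close> unit-cost steps,
  and no number greater than \<open>B\<close> is ever created. A run that would exceed \<open>B\<close> has no derivation.
  Subtraction is truncated at zero.
\<close>

inductive exec :: "nat \<Rightarrow> com \<Rightarrow> state \<Rightarrow> nat \<Rightarrow> state \<Rightarrow> bool" for B where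
  Skip: "exec B Skip s 1 s"
| Const: "n \<le> B \<Longrightarrow> exec B (Const i n) (r, m) 1 (r(i := n), m)"
| Copy: "exec B (Copy i j) (r, m) 1 (r(i := r j), m)"
| Add: "r j + r k \<le> B \<Longrightarrow> exec B (Add i j k) (r, m) 1 (r(i := r j + r k), m)"
| Sub: "exec B (Sub i j k) (r, m) 1 (r(i := r j - r k), m)"
| Load: "exec B (Load i j) (r, m) 1 (r(i := m (r j)), m)"
| Store: "exec B (Store i j) (r, m) 1 (r, m(r i := r j))"
| Seq: "\<lbrakk>exec B P s t s'; exec B Q s' u s''\<rbrakk> \<Longrightarrow> exec B (Seq P Q) s (t + u) s''"
| IfTrue: "\<lbrakk>holds b s; exec B P s t s'\<rbrakk> \<Longrightarrow> exec B (If b P Q) s (1 + t) s'"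
| IfFalse: "\<lbrakk>\<not> holds b s; exec B Q s t s'\<rbrakk> \<Longrightarrow> exec B (If b P Q) s (1 + t) s'"
| WhileFalse: "\<not> holds b s \<Longrightarrow> exec B (While b P) s 1 s"
| WhileTrue: "\<lbrakk>holds b s; exec B P s t s'; exec B (While b P) s' u s''\<rbrakk>
    \<Longrightarrow> exec B (While b P) s (1 + t + u) s''"

text \<open>
  A word of numbers is passed to and returned by a program in the memory cells \<open>0, 1, \<dots>\<close>,
  with its length in register \<open>0\<close>. Everything else is zero initially.
\<close>

definition input_state :: "nat list \<Rightarrow> state" where
  "input_state xs =
     ((\<lambda>i. if i = 0 then length xs else 0), (\<lambda>a. if a < length xs then xs ! a else 0))"

fun output_word :: "state \<Rightarrow> nat list" where
  "output_word (r, m) = map m [0..<r 0]"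

text \<open>
  Linear time on a machine whose words have logarithmic length: both the number of steps and
  the numbers created are linear in the length of the input.
\<close>

definition linear_time_computable ::
    "('i \<Rightarrow> bool) \<Rightarrow> ('i \<Rightarrow> nat list) \<Rightarrow> ('i \<Rightarrow> nat list \<Rightarrow> bool) \<Rightarrow> bool" where
  "linear_time_computable is_instance encode is_solution \<longleftrightarrow>
     (\<exists>P c. \<forall>x. is_instance x \<longrightarrow>
       (\<exists>t s. exec (c * length (encode x)) P (input_state (encode x)) t s \<and>
          t \<le> c * length (encode x) \<and> is_solution x (output_word s)))"

section \<open>Representation of the inputs and outputs\<close>

text \<open>
  As usual in algorithmic settings the vertices of the input digraph are \<open>0, \<dots>, n - 1\<close>.
  The lists of out-neighbors may be in any order.
\<close>

definition is_adjacency_list :: "nat list list \<Rightarrow> nat pair_pre_digraph \<Rightarrow> bool" where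
  "is_adjacency_list A G \<longleftrightarrow> pverts G = {..<length A} \<and>
     (\<forall>v<length A. distinct (A ! v) \<and> set (A ! v) = {w. (v, w) \<in> parcs G})"

definition encode_adjacency_list :: "nat list list \<Rightarrow> nat list" where
  "encode_adjacency_list A = length A # concat (map (\<lambda>ws. length ws # ws) A)"

text \<open>Trees are written in preorder.\<close>

fun encode_cotree :: "nat cotree \<Rightarrow> nat list" where
  "encode_cotree (Leaf v) = [0, v]"
| "encode_cotree (DUnion S T) = 1 # encode_cotree S @ encode_cotree T"
| "encode_cotree (Series S T) = 2 # encode_cotree S @ encode_cotree T"

text \<open>The output is the dichromatic number, followed by the colors of \<open>0, \<dots>, n - 1\<close>.\<close>

definition is_optimal_coloring_output :: "nat pair_pre_digraph \<Rightarrow> nat list \<Rightarrow> bool" where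
  "is_optimal_coloring_output G xs \<longleftrightarrow>
     (\<exists>c. acyclic_coloring G (dichromatic_number G) c \<and>
        xs = dichromatic_number G # map c [0..<card (pverts G)])"

text \<open>
  The lengths of the inputs: linear in the number of vertices and arcs, and in the number of
  vertices, respectively.
\<close>

lemma length_encode_adjacency_list:
  assumes "pair_fin_digraph G" "is_adjacency_list A G"
  shows "length (encode_adjacency_list A) = 1 + card (pverts G) + card (parcs G)"
proof -
  interpret pair_fin_digraph G by fact
  have A: "set (A ! v) = {w. (v, w) \<in> parcs G}" "distinct (A ! v)" if "v < length A" for v
    using assms(2) that by (auto simp: is_adjacency_list_def)
  have V: "pverts G = {..<length A}"
    using assms(2) by (simp add: is_adjacency_list_def)
  have "parcs G = (SIGMA v:{..<length A}. set (A ! v))"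
  proof (rule set_eqI)
    fix e :: "nat \<times> nat"
    obtain v w where "e = (v, w)"
      by (cases e)
    then show "e \<in> parcs G \<longleftrightarrow> e \<in> (SIGMA v:{..<length A}. set (A ! v))"
      using A(1)[of v] in_arcsD1[of v w] V by (cases "v < length A") auto
  qed
  then have "card (parcs G) = (\<Sum>v<length A. length (A ! v))"
    by (simp add: card_SigmaI distinct_card A(2))
  also have "\<dots> = sum_list (map length A)"
    by (simp add: sum_list_sum_nth atLeast0LessThan)
  finally have "card (parcs G) = sum_list (map length A)" .
  moreover have "length (concat (map (\<lambda>ws. length ws # ws) A)) = length A + sum_list (map length A)"
    by (simp add: length_concat comp_def sum_list_addf sum_list_Suc)
  ultimately show ?thesis
    by (simp add: encode_adjacency_list_def V)
qed

lemma length_encode_cotree: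
  "ex_di_cotree T G \<Longrightarrow> finite (pverts G) \<and> length (encode_cotree T) + 1 = 3 * card (pverts G)"
proof (induction rule: ex_di_cotree.induct)
  case (dunion S G T H D)
  then have "pverts D = pverts G \<union> pverts H"
    by (auto simp: is_directed_union_def subgraph_def order_composition_def disjoint_union_def)
  with dunion show ?case
    by (simp add: card_Un_disjoint)
qed (auto simp: single_vertex_def series_composition_def card_Un_disjoint)

end

(*
  Mutually adjacent vertices arise only from series compositions, and a vertex set without them is
  acyclic, so the acyclic colorings are the proper colorings of the graph of mutual adjacency, which
  is a co-graph. On a co-graph every coloring in which each vertex sees all smaller colors uses no
  more colors than some clique has vertices. Hence for adjacency lists, first-fit coloring in the
  order 0, ..., n - 1 is optimal, and no co-tree needs to be computed. For an ex-di-co-tree, one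
  traversal with an explicit stack suffices: in a series composition, the colors on the right are
  shifted by the number of colors on the left, which is known when the traversal enters the right.
*)
theory Submission
  imports Defs
begin

section \<open>Acyclic colorings of extended directed co-graphs\<close>

text \<open>Disjoint union and order composition are the least and the greatest directed union, so
  one structure theory serves both classes. Lower bounds always come from a clique of mutual
  adjacency with as many vertices as there are colors. The obstacle is the machine: mutual adjacency
  of a pair cannot be looked up, since an adjacency matrix would need quadratically many cells.
  Instead, arcs are grouped by their heads while they are read, and an earlier in-neighbor of
  \<open>v\<close> is mutually adjacent to \<open>v\<close> iff \<open>v\<close> has just marked it
  as an out-neighbor. The work at \<open>v\<close>, including the search for its color, is then
  linear in its out-degree plus the number of its earlier in-neighbors, and both sum to at most the
  number of arcs. All addresses stay within \<open>6 * L\<close>; the generous factor 200 bounds the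
  steps and the created numbers alike.\<close>

definition mutual :: "'a pair_pre_digraph \<Rightarrow> 'a \<Rightarrow> 'a \<Rightarrow> bool" where
  "mutual G u v \<longleftrightarrow> (u, v) \<in> parcs G \<and> (v, u) \<in> parcs G"

definition mutual_clique :: "'a pair_pre_digraph \<Rightarrow> 'a set \<Rightarrow> bool" where
  "mutual_clique G K \<longleftrightarrow>
     finite K \<and> K \<subseteq> pverts G \<and> (\<forall>u\<in>K. \<forall>v\<in>K. u \<noteq> v \<longrightarrow> mutual G u v)"

definition mutual_proper :: "'a pair_pre_digraph \<Rightarrow> ('a \<Rightarrow> nat) \<Rightarrow> bool" where
  "mutual_proper G c \<longleftrightarrow> (\<forall>u v. mutual G u v \<longrightarrow> c u \<noteq> c v)"

lemma directed_unionD: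
  assumes "is_directed_union G H D"
  shows "pverts D = pverts G \<union> pverts H"
    and "parcs G \<union> parcs H \<subseteq> parcs D"
    and "parcs D \<subseteq> parcs G \<union> parcs H \<union> pverts G \<times> pverts H"
  using assms
  by (auto simp: is_directed_union_def subgraph_def order_composition_def disjoint_union_def)

lemma ext_directed_cograph_finite: "ext_directed_cograph G \<Longrightarrow> finite (pverts G)"
  by (induction rule: ext_directed_cograph.induct)
    (auto simp: single_vertex_def series_composition_def dest: directed_unionD(1))

lemma ext_directed_cograph_arcD:
  assumes "ext_directed_cograph G" "(u, v) \<in> parcs G"
  shows "u \<in> pverts G" "v \<in> pverts G" "u \<noteq> v"
proof -
  from assms have "u \<in> pverts G \<and> v \<in> pverts G \<and> u \<noteq> v"
  proof induction
    case (single w)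
    then show ?case
      by (simp add: single_vertex_def)
  next
    case (dunion G H D)
    then have "(u, v) \<in> parcs G \<or> (u, v) \<in> parcs H \<or> u \<in> pverts G \<and> v \<in> pverts H"
      using directed_unionD(3)[OF dunion.hyps(4)] by auto
    then show ?case
      using dunion.IH dunion.hyps(3) directed_unionD(1)[OF dunion.hyps(4)]
      by (metis UnI1 UnI2 disjoint_iff)
  next
    case (series G H)
    then have "(u, v) \<in> parcs G \<or> (u, v) \<in> parcs H \<or> u \<in> pverts G \<and> v \<in> pverts H
        \<or> u \<in> pverts H \<and> v \<in> pverts G"
      by (auto simp: series_composition_def)
    moreover have "pverts (series_composition G H) = pverts G \<union> pverts H"
      by (simp add: series_composition_def)
    ultimately show ?case
      using series.IH series.hyps(3) by (metis UnI1 UnI2 disjoint_iff)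
  qed
  then show "u \<in> pverts G" "v \<in> pverts G" "u \<noteq> v"
    by auto
qed

lemma ext_directed_cograph_arcs:
  assumes "ext_directed_cograph G"
  shows "finite (pverts G)" "parcs G \<subseteq> pverts G \<times> pverts G"
  using ext_directed_cograph_finite[OF assms] ext_directed_cograph_arcD[OF assms] by auto

text \<open>The two extreme directed unions contain none or all of the arcs from left to right. That
  arcs stay within the vertex set is needed for the well-formedness part of
  \<open>subgraph\<close>.\<close>

lemma directed_cograph_imp_ext_directed_cograph:
  "directed_cograph G \<Longrightarrow> ext_directed_cograph G"
proof (induction rule: directed_cograph.induct)
  case (union G H)
  then have "is_directed_union G H (disjoint_union G H)"
    using ext_directed_cograph_arcs[of G] ext_directed_cograph_arcs[of H]
    by (auto simp: is_directed_union_def subgraph_def order_composition_def disjoint_union_def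
        compatible_def wf_digraph_def)
  with union show ?case
    by (blast intro: ext_directed_cograph.dunion)
next
  case (order G H)
  then have "is_directed_union G H (order_composition G H)"
    using ext_directed_cograph_arcs[of G] ext_directed_cograph_arcs[of H]
    by (auto simp: is_directed_union_def subgraph_def order_composition_def disjoint_union_def
        compatible_def wf_digraph_def)
  with order show ?case
    by (blast intro: ext_directed_cograph.dunion)
qed (blast intro: ext_directed_cograph.intros)+

section \<open>Mutual adjacency under directed union and series composition\<close>

lemma mutual_verts:
  assumes "ext_directed_cograph G" "mutual G u v"
  shows "u \<in> pverts G" "v \<in> pverts G" "u \<noteq> v"
  using ext_directed_cograph_arcD[OF assms(1)] assms(2) unfolding mutual_def by auto

text \<open>Arcs between the operands run in one direction only, so no new mutual pair
  arises.\<close>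

lemma mutual_directed_union:
  assumes "ext_directed_cograph G" "ext_directed_cograph H" "pverts G \<inter> pverts H = {}"
    and "is_directed_union G H D"
  shows "mutual D u v \<longleftrightarrow> mutual G u v \<or> mutual H u v"
proof
  have D: "(u, v) \<in> parcs G \<or> (u, v) \<in> parcs H \<or> u \<in> pverts G \<and> v \<in> pverts H"
    if "(u, v) \<in> parcs D" for u v
    using directed_unionD(3)[OF assms(4)] that by auto
  assume "mutual D u v"
  then show "mutual G u v \<or> mutual H u v"
    using D[of u v] D[of v u] ext_directed_cograph_arcD(1,2)[OF assms(1)]
      ext_directed_cograph_arcD(1,2)[OF assms(2)] assms(3)
    unfolding mutual_def by (metis disjoint_iff)
next
  assume "mutual G u v \<or> mutual H u v"
  then show "mutual D u v"
    using directed_unionD(2)[OF assms(4)] by (auto simp: mutual_def)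
qed

lemma mutual_series_composition:
  assumes "ext_directed_cograph G" "ext_directed_cograph H" "pverts G \<inter> pverts H = {}"
  shows "mutual (series_composition G H) u v \<longleftrightarrow> mutual G u v \<or> mutual H u v \<or>
    u \<in> pverts G \<and> v \<in> pverts H \<or> u \<in> pverts H \<and> v \<in> pverts G"
proof -
  have "u \<notin> pverts G \<or> u \<notin> pverts H" "v \<notin> pverts G \<or> v \<notin> pverts H"
    using assms(3) by auto
  then show ?thesis
    using ext_directed_cograph_arcD(1,2)[OF assms(1)] ext_directed_cograph_arcD(1,2)[OF assms(2)]
    unfolding mutual_def series_composition_def by auto
qed

text \<open>
  A set without two mutually adjacent vertices meets at most one side of each series composition,
  and it can be sorted topologically by placing the left side of each directed union first.
\<close>

lemma rank_if_no_mutual: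
  assumes "ext_directed_cograph G" "\<forall>u\<in>S. \<forall>v\<in>S. \<not> mutual G u v"
  shows "\<exists>f :: 'a \<Rightarrow> nat. \<forall>(u, v) \<in> parcs G \<inter> S \<times> S. f u < f v"
  using assms
proof induction
  case (single v)
  then show ?case
    by (simp add: single_vertex_def)
next
  case (dunion G H D)
  note D = directed_unionD[OF dunion.hyps(4)]
  note G = ext_directed_cograph_arcs[OF dunion.hyps(1)]
  note H = ext_directed_cograph_arcs[OF dunion.hyps(2)]
  obtain f g :: "'a \<Rightarrow> nat" where
    f: "\<forall>(u, v) \<in> parcs G \<inter> S \<times> S. f u < f v" and g: "\<forall>(u, v) \<in> parcs H \<inter> S \<times> S. g u < g v"
    using dunion.IH dunion.prems mutual_directed_union[OF dunion.hyps] by meson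
  define h where "h v = (if v \<in> pverts G then f v else g v + Suc (Max (f ` pverts G)))" for v
  have "h u < h v" if uv: "(u, v) \<in> parcs D" "u \<in> S" "v \<in> S" for u v
  proof -
    consider "(u, v) \<in> parcs G" | "(u, v) \<in> parcs H" | "u \<in> pverts G" "v \<in> pverts H"
      using uv(1) D(3) by auto
    then show ?thesis
    proof cases
      case 1
      then show ?thesis
        using G(2) f uv by (auto simp: h_def)
    next
      case 2
      then have "u \<notin> pverts G" "v \<notin> pverts G"
        using H(2) dunion.hyps(3) by auto
      then show ?thesis
        using 2 g uv by (auto simp: h_def)
    next
      case 3
      then have "f u \<le> Max (f ` pverts G)" "v \<notin> pverts G"
        using G(1) dunion.hyps(3) by auto
      then show ?thesis
        using 3 by (simp add: h_def)
    qed
  qed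
  then show ?case
    by (intro exI[of _ h]) auto
next
  case (series G H)
  note mut = mutual_series_composition[OF series.hyps]
  obtain f g :: "'a \<Rightarrow> nat" where
    f: "\<forall>(u, v) \<in> parcs G \<inter> S \<times> S. f u < f v" and g: "\<forall>(u, v) \<in> parcs H \<inter> S \<times> S. g u < g v"
    using series.IH series.prems mut by meson
  have "S \<inter> pverts G = {} \<or> S \<inter> pverts H = {}"
    using series.prems mut by blast
  then show ?case
  proof
    assume "S \<inter> pverts G = {}"
    then show ?thesis
      using g ext_directed_cograph_arcs(2)[OF series.hyps(1)]
      by (intro exI[of _ g]) (auto simp: series_composition_def)
  next
    assume "S \<inter> pverts H = {}"
    then show ?thesis
      using f ext_directed_cograph_arcs(2)[OF series.hyps(2)]
      by (intro exI[of _ f]) (auto simp: series_composition_def)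
  qed
qed

text \<open>A mutual pair is a cycle of length two. Conversely, the rank grows along every arc, so a
  closed walk must be empty.\<close>

lemma acyclic_set_iff_no_mutual:
  assumes "ext_directed_cograph G" "S \<subseteq> pverts G"
  shows "acyclic_set G S \<longleftrightarrow> (\<forall>u\<in>S. \<forall>v\<in>S. \<not> mutual G u v)"
proof
  assume acyc: "acyclic_set G S"
  show "\<forall>u\<in>S. \<forall>v\<in>S. \<not> mutual G u v"
  proof (intro ballI notI)
    fix u v assume uv: "u \<in> S" "v \<in> S" "mutual G u v"
    then have "u \<noteq> v"
      using mutual_verts(3)[OF assms(1)] by blast
    then have "pre_digraph.cycle (with_proj G \<restriction> S) [(u, v), (v, u)]"
      using uv unfolding pre_digraph.cycle_def pre_digraph.awalk_def mutual_def
      by (intro exI[of _ u])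
        (auto simp: induce_subgraph_def pre_digraph.cas.simps pre_digraph.awalk_verts.simps)
    with acyc show False
      by (auto simp: acyclic_set_def)
  qed
next
  assume indep: "\<forall>u\<in>S. \<forall>v\<in>S. \<not> mutual G u v"
  obtain f :: "'a \<Rightarrow> nat" where f: "\<forall>(u, v) \<in> parcs G \<inter> S \<times> S. f u < f v"
    using rank_if_no_mutual[OF assms(1) indep] by blast
  let ?H = "with_proj G \<restriction> S"
  \<comment> \<open>Stated with the length of the walk, so that \<open>u = v\<close> forces
    \<open>p = []\<close>.\<close>
  have "f u + length p \<le> f v" if "pre_digraph.cas ?H u p v" "set p \<subseteq> arcs ?H" for u p v
    using that
  proof (induction p arbitrary: u)
    case Nil
    then show ?case
      by (simp add: pre_digraph.cas.simps)
  next
    case (Cons e p)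
    then have "f u < f (snd e)" "f (snd e) + length p \<le> f v"
      using f by (cases e; force simp: pre_digraph.cas.simps induce_subgraph_def)+
    then show ?case
      by simp
  qed
  then have "\<not> pre_digraph.cycle ?H p" for p
    unfolding pre_digraph.cycle_def pre_digraph.awalk_def by fastforce
  with assms(2) show "acyclic_set G S"
    by (simp add: acyclic_set_def)
qed

text \<open>Two vertices of a clique in one color class would form a cycle of length two, so every
  acyclic coloring is injective on the clique. A clique and a proper coloring of equal size thus
  certify each other.\<close>

lemma dichromatic_number_eqI:
  assumes G: "ext_directed_cograph G"
    and c: "c ` pverts G \<subseteq> {1..r}" "mutual_proper G c"
    and K: "mutual_clique G K" "card K = r"
  shows "dichromatic_number G = r" "acyclic_coloring G r c"
proof -
  show col: "acyclic_coloring G r c"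
    unfolding acyclic_coloring_def
  proof (intro conjI ballI)
    show "acyclic_set G {v \<in> pverts G. c v = i}" for i
      using c(2) unfolding mutual_proper_def
      by (subst acyclic_set_iff_no_mutual[OF G]) force+
  qed (fact c(1))
  show "dichromatic_number G = r"
    unfolding dichromatic_number_def
  proof (rule Least_equality)
    show "\<exists>c. acyclic_coloring G r c"
      using col by blast
  next
    fix q assume "\<exists>d. acyclic_coloring G q d"
    then obtain d where d: "acyclic_coloring G q d" ..
    have dK: "d ` K \<subseteq> {1..q}"
      using d K(1) by (auto simp: acyclic_coloring_def mutual_clique_def)
    have "inj_on d K"
    proof (rule inj_onI, rule ccontr)
      fix u v assume uv: "u \<in> K" "v \<in> K" "d u = d v" "u \<noteq> v"
      let ?S = "{w \<in> pverts G. d w = d u}"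
      have "acyclic_set G ?S"
        using d dK uv(1) by (auto simp: acyclic_coloring_def)
      moreover have "mutual G u v" "u \<in> ?S" "v \<in> ?S"
        using K(1) uv by (auto simp: mutual_clique_def)
      ultimately show False
        using acyclic_set_iff_no_mutual[OF G, of ?S] by blast
    qed
    then show "r \<le> q"
      using card_inj_on_le[OF _ dK] K(2) by simp
  qed
qed

lemma clique_series_composition:
  assumes "ext_directed_cograph G" "ext_directed_cograph H" "pverts G \<inter> pverts H = {}"
    and "mutual_clique G K" "mutual_clique H M"
  shows "mutual_clique (series_composition G H) (K \<union> M)" "card (K \<union> M) = card K + card M"
proof -
  have "K \<inter> M = {}"
    using assms(3-) by (auto simp: mutual_clique_def)
  then show "card (K \<union> M) = card K + card M"
    using assms(4,5) by (auto simp: mutual_clique_def intro: card_Un_disjoint)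
  have "pverts (series_composition G H) = pverts G \<union> pverts H"
    by (simp add: series_composition_def)
  then show "mutual_clique (series_composition G H) (K \<union> M)"
    using assms(4,5)
    unfolding mutual_clique_def mutual_series_composition[OF assms(1-3)] by auto
qed

lemma clique_directed_union:
  assumes "ext_directed_cograph G" "ext_directed_cograph H" "pverts G \<inter> pverts H = {}"
    and "is_directed_union G H D" and "mutual_clique G K \<or> mutual_clique H K"
  shows "mutual_clique D K"
  using assms(5) directed_unionD(1)[OF assms(4)]
  unfolding mutual_clique_def mutual_directed_union[OF assms(1-4)] by auto

text \<open>A Grundy coloring, relative to the colors that occur: on one side of a series
  composition these need not be an initial segment, and the property has to pass to both
  sides.\<close>

definition grundy :: "'a pair_pre_digraph \<Rightarrow> ('a \<Rightarrow> nat) \<Rightarrow> bool" where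
  "grundy G c \<longleftrightarrow> mutual_proper G c \<and>
     (\<forall>v\<in>pverts G. \<forall>i\<in>c ` pverts G. i < c v \<longrightarrow> (\<exists>u. mutual G u v \<and> c u = i))"

lemma grundyD:
  assumes "grundy G c"
  shows "mutual G u v \<Longrightarrow> c u \<noteq> c v"
    and "v \<in> pverts G \<Longrightarrow> i \<in> c ` pverts G \<Longrightarrow> i < c v \<Longrightarrow> \<exists>u. mutual G u v \<and> c u = i"
  using assms unfolding grundy_def mutual_proper_def by blast+

text \<open>
  In a directed union the color set of each side is closed downwards in the set of all colors,
  so one side already uses all colors.
\<close>

lemma clique_if_grundy:
  assumes "ext_directed_cograph G" "grundy G c"
  shows "\<exists>K. mutual_clique G K \<and> card K = card (c ` pverts G)"
  using assms
proof induction
  case (single v)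
  then show ?case
    by (intro exI[of _ "{v}"]) (simp add: mutual_clique_def single_vertex_def)
next
  case (dunion G H D)
  note mut = mutual_directed_union[OF dunion.hyps]
  note vD = directed_unionD(1)[OF dunion.hyps(4)]
  \<comment> \<open>Here \<open>i\<close> ranges over the colors of the whole union: as there are no
    mutual pairs across, the neighbor of color \<open>i\<close> lies on the side of
    \<open>v\<close>, and hence so does the color.\<close>
  have G: "i \<in> c ` pverts G \<and> (\<exists>u. mutual G u v \<and> c u = i)"
    if v: "v \<in> pverts G" "i \<in> c ` pverts D" "i < c v" for v i
  proof -
    obtain u where "mutual D u v" "c u = i"
      using grundyD(2)[OF dunion.prems, of v i] v vD by auto
    then show ?thesis
      using mut mutual_verts[OF dunion.hyps(1), of u v] mutual_verts[OF dunion.hyps(2), of u v]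
        v(1) dunion.hyps(3) by (auto simp: disjoint_iff)
  qed
  have H: "i \<in> c ` pverts H \<and> (\<exists>u. mutual H u v \<and> c u = i)"
    if v: "v \<in> pverts H" "i \<in> c ` pverts D" "i < c v" for v i
  proof -
    obtain u where "mutual D u v" "c u = i"
      using grundyD(2)[OF dunion.prems, of v i] v vD by auto
    then show ?thesis
      using mut mutual_verts[OF dunion.hyps(1), of u v] mutual_verts[OF dunion.hyps(2), of u v]
        v(1) dunion.hyps(3) by (auto simp: disjoint_iff)
  qed
  have sub: "c ` pverts G \<subseteq> c ` pverts D" "c ` pverts H \<subseteq> c ` pverts D"
    using vD by auto
  have "grundy G c"
    unfolding grundy_def mutual_proper_def
    using G sub(1) grundyD(1)[OF dunion.prems] mut by (meson subsetD)
  moreover have "grundy H c"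
    unfolding grundy_def mutual_proper_def
    using H sub(2) grundyD(1)[OF dunion.prems] mut by (meson subsetD)
  ultimately obtain K M where K: "mutual_clique G K" "card K = card (c ` pverts G)"
    and M: "mutual_clique H M" "card M = card (c ` pverts H)"
    using dunion.IH by blast
  have "c ` pverts G \<subseteq> c ` pverts H \<or> c ` pverts H \<subseteq> c ` pverts G"
  proof (rule disjCI)
    assume "\<not> c ` pverts H \<subseteq> c ` pverts G"
    then obtain w where w: "w \<in> pverts H" "c w \<notin> c ` pverts G"
      by blast
    show "c ` pverts G \<subseteq> c ` pverts H"
    proof (rule image_subsetI)
      fix v assume v: "v \<in> pverts G"
      \<comment> \<open>A left vertex colored above \<open>c w\<close> would see color
        \<open>c w\<close> on the left, where it is missing. So all left colors lie below
        \<open>c w\<close>, and \<open>w\<close> sees them on the right.\<close>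
      have "\<not> c w < c v"
        using G[OF v, of "c w"] w sub by blast
      moreover have "c w \<noteq> c v"
        using w v by auto
      ultimately show "c v \<in> c ` pverts H"
        using H[OF w(1), of "c v"] v sub by auto
    qed
  qed
  then have "c ` pverts D = c ` pverts G \<or> c ` pverts D = c ` pverts H"
    using vD by (auto simp: image_Un)
  then show ?case
    using K M clique_directed_union[OF dunion.hyps] by metis
next
  case (series G H)
  let ?D = "series_composition G H"
  note mut = mutual_series_composition[OF series.hyps]
  have vD: "pverts ?D = pverts G \<union> pverts H"
    by (simp add: series_composition_def)
  \<comment> \<open>All pairs across are mutually adjacent, so the sides share no color. Color
    counts therefore add up, and the witness of a smaller color stays on its own side.\<close>
  have "c u \<noteq> c v" if "u \<in> pverts G" "v \<in> pverts H" for u v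
    using grundyD(1)[OF series.prems, of u v] that unfolding mut by blast
  then have disj: "c ` pverts G \<inter> c ` pverts H = {}"
    by fastforce
  have "grundy G c"
    unfolding grundy_def
  proof (intro conjI ballI impI)
    show "mutual_proper G c"
      using grundyD(1)[OF series.prems] unfolding mut mutual_proper_def by simp
    fix v i assume v: "v \<in> pverts G" "i \<in> c ` pverts G" "i < c v"
    then obtain u where "mutual ?D u v" "c u = i"
      using grundyD(2)[OF series.prems, of v i] vD by auto
    then show "\<exists>u. mutual G u v \<and> c u = i"
      using mut v disj mutual_verts[OF series.hyps(2), of u v] series.hyps(3)
      by (auto simp: disjoint_iff)
  qed
  moreover have "grundy H c"
    unfolding grundy_def
  proof (intro conjI ballI impI)
    show "mutual_proper H c"
      using grundyD(1)[OF series.prems] unfolding mut mutual_proper_def by simp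
    fix v i assume v: "v \<in> pverts H" "i \<in> c ` pverts H" "i < c v"
    then obtain u where "mutual ?D u v" "c u = i"
      using grundyD(2)[OF series.prems, of v i] vD by auto
    then show "\<exists>u. mutual H u v \<and> c u = i"
      using mut v disj mutual_verts[OF series.hyps(1), of u v] series.hyps(3)
      by (auto simp: disjoint_iff)
  qed
  ultimately obtain K M where K: "mutual_clique G K" "card K = card (c ` pverts G)"
    and M: "mutual_clique H M" "card M = card (c ` pverts H)"
    using series.IH by blast
  have "card (c ` pverts ?D) = card (c ` pverts G) + card (c ` pverts H)"
    using disj ext_directed_cograph_arcs(1)[OF series.hyps(1)]
      ext_directed_cograph_arcs(1)[OF series.hyps(2)]
    by (simp add: vD image_Un card_Un_disjoint)
  then show ?case
    using clique_series_composition[OF series.hyps K(1) M(1)] K(2) M(2) by metis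
qed

lemma optimal_coloring_if_grundy:
  assumes "ext_directed_cograph G" "grundy G c" "c ` pverts G = {1..r}"
  shows "dichromatic_number G = r" "acyclic_coloring G r c"
proof -
  obtain K where "mutual_clique G K" "card K = r"
    using clique_if_grundy[OF assms(1,2)] assms(3) by auto
  then show "dichromatic_number G = r" "acyclic_coloring G r c"
    using dichromatic_number_eqI[of G c r K] assms by (auto simp: grundy_def)
qed

fun cotree_number :: "'a cotree \<Rightarrow> nat" where
  "cotree_number (Leaf v) = 1"
| "cotree_number (DUnion S T) = max (cotree_number S) (cotree_number T)"
| "cotree_number (Series S T) = cotree_number S + cotree_number T"

text \<open>A leaf ignores its argument to keep the function total; only the values on
  \<open>set_cotree\<close> matter.\<close>

fun cotree_color :: "'a cotree \<Rightarrow> 'a \<Rightarrow> nat" where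
  "cotree_color (Leaf u) v = 1"
| "cotree_color (DUnion S T) v = (if v \<in> set_cotree S then cotree_color S v else cotree_color T v)"
| "cotree_color (Series S T) v =
     (if v \<in> set_cotree S then cotree_color S v else cotree_number S + cotree_color T v)"

lemma pverts_cotree: "ex_di_cotree T G \<Longrightarrow> pverts G = set_cotree T"
  by (induction rule: ex_di_cotree.induct)
    (auto simp: single_vertex_def series_composition_def dest: directed_unionD(1))

lemma ext_directed_cograph_if_cotree: "ex_di_cotree T G \<Longrightarrow> ext_directed_cograph G"
  by (auto simp: ext_directed_cograph_iff_cotree)

lemma cotree_color_bounds:
  "v \<in> set_cotree T \<Longrightarrow> 1 \<le> cotree_color T v \<and> cotree_color T v \<le> cotree_number T"
  by (induction T) (auto simp: le_max_iff_disj)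

lemma mutual_proper_cotree_color: "ex_di_cotree T G \<Longrightarrow> mutual_proper G (cotree_color T)"
proof (induction rule: ex_di_cotree.induct)
  case (leaf v)
  then show ?case
    by (simp add: mutual_proper_def mutual_def single_vertex_def)
next
  case (dunion S G T H D)
  note ext = dunion.hyps(1,2)[THEN ext_directed_cograph_if_cotree]
  show ?case
    unfolding mutual_proper_def mutual_directed_union[OF ext dunion.hyps(3,4)]
    using dunion.IH dunion.hyps(3) mutual_verts[OF ext(1)] mutual_verts[OF ext(2)]
      pverts_cotree[OF dunion.hyps(1)] pverts_cotree[OF dunion.hyps(2)]
    unfolding mutual_proper_def by (auto simp: disjoint_iff)
next
  case (series S G T H)
  note ext = series.hyps(1,2)[THEN ext_directed_cograph_if_cotree]
  have sep: "cotree_color S u < cotree_number S + cotree_color T v"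
    if "u \<in> set_cotree S" "v \<in> set_cotree T" for u v
    using cotree_color_bounds[OF that(1)] cotree_color_bounds[OF that(2)] by simp
  have verts: "pverts G = set_cotree S" "pverts H = set_cotree T"
    using series.hyps(1,2) by (auto simp: pverts_cotree)
  show ?case
    unfolding mutual_proper_def
  proof (intro allI impI)
    fix u v assume "mutual (series_composition G H) u v"
    then consider "mutual G u v" | "mutual H u v"
      | "u \<in> pverts G" "v \<in> pverts H" | "u \<in> pverts H" "v \<in> pverts G"
      unfolding mutual_series_composition[OF ext series.hyps(3)] by blast
    then show "cotree_color (Series S T) u \<noteq> cotree_color (Series S T) v"
    proof cases
      case 1
      then show ?thesis
        using mutual_verts[OF ext(1) 1] series.IH(1) by (auto simp: verts mutual_proper_def)
    next
      case 2
      then have "u \<notin> set_cotree S" "v \<notin> set_cotree S"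
        using mutual_verts[OF ext(2) 2] series.hyps(3) by (auto simp: verts)
      then show ?thesis
        using 2 series.IH(2) by (auto simp: mutual_proper_def)
    next
      case 3
      then show ?thesis
        using sep[of u v] series.hyps(3) by (auto simp: verts)
    next
      case 4
      then show ?thesis
        using sep[of v u] series.hyps(3) by (auto simp: verts)
    qed
  qed
qed

text \<open>The larger of the two cliques survives a directed union, and the union of both is a
  clique in a series composition.\<close>

lemma clique_cotree_number:
  "ex_di_cotree T G \<Longrightarrow> \<exists>K. mutual_clique G K \<and> card K = cotree_number T"
proof (induction rule: ex_di_cotree.induct)
  case (leaf v)
  then show ?case
    by (intro exI[of _ "{v}"]) (simp add: mutual_clique_def single_vertex_def)
next
  case (dunion S G T H D)
  then show ?case
    using clique_directed_union[OF dunion.hyps(1,2)[THEN ext_directed_cograph_if_cotree] dunion.hyps(3,4)]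
    by (cases "cotree_number S \<le> cotree_number T") (auto simp: max_def)
next
  case (series S G T H)
  then show ?case
    using clique_series_composition[OF series.hyps(1,2)[THEN ext_directed_cograph_if_cotree] series.hyps(3)]
    by (metis cotree_number.simps(3))
qed

lemma optimal_cotree_color:
  assumes "ex_di_cotree T G"
  shows "dichromatic_number G = cotree_number T" "acyclic_coloring G (cotree_number T) (cotree_color T)"
proof -
  obtain K where K: "mutual_clique G K" "card K = cotree_number T"
    using clique_cotree_number[OF assms] by blast
  have c: "cotree_color T ` pverts G \<subseteq> {1..cotree_number T}"
    using cotree_color_bounds pverts_cotree[OF assms] by fastforce
  show "dichromatic_number G = cotree_number T"
    "acyclic_coloring G (cotree_number T) (cotree_color T)"
    using dichromatic_number_eqI[OF ext_directed_cograph_if_cotree[OF assms] c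
        mutual_proper_cotree_color[OF assms] K] by blast+
qed

section \<open>Reasoning about programs and their running times\<close>

notation Seq (infixr \<open>;;\<close> 60)

text \<open>\<open>k\<close> is the number of steps that may still be spent, and \<open>Q\<close> gets what is left of it.\<close>

definition wp :: "nat \<Rightarrow> com \<Rightarrow> ((nat \<Rightarrow> nat) \<Rightarrow> (nat \<Rightarrow> nat) \<Rightarrow> nat \<Rightarrow> bool) \<Rightarrow>
    (nat \<Rightarrow> nat) \<Rightarrow> (nat \<Rightarrow> nat) \<Rightarrow> nat \<Rightarrow> bool" where
  "wp B P Q r m k \<longleftrightarrow> (\<exists>t r' m'. exec B P (r, m) t (r', m') \<and> t \<le> k \<and> Q r' m' (k - t))"

inductive_cases exec_SkipE: "exec B Skip s t s'"
inductive_cases exec_ConstE: "exec B (Const i n) s t s'"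
inductive_cases exec_CopyE: "exec B (Copy i j) s t s'"
inductive_cases exec_AddE: "exec B (Add i j l) s t s'"
inductive_cases exec_SubE: "exec B (Sub i j l) s t s'"
inductive_cases exec_LoadE: "exec B (Load i j) s t s'"
inductive_cases exec_StoreE: "exec B (Store i j) s t s'"
inductive_cases exec_SeqE: "exec B (Seq P P') s t s'"
inductive_cases exec_IfE: "exec B (If b P P') s t s'"

text \<open>The rules for loop-free commands are equivalences, so the simplifier executes such code
  symbolically. Loops get introduction rules only, as an equivalence would unfold forever.\<close>

lemma wp_Skip [simp]: "wp B Skip Q r m k \<longleftrightarrow> 0 < k \<and> Q r m (k - 1)"
  unfolding wp_def by (fastforce intro: exec.intros elim: exec_SkipE)

lemma wp_Const [simp]:
  "wp B (Const i n) Q r m k \<longleftrightarrow> n \<le> B \<and> 0 < k \<and> Q (r(i := n)) m (k - 1)"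
  unfolding wp_def by (fastforce intro: exec.intros elim: exec_ConstE)

lemma wp_Copy [simp]:
  "wp B (Copy i j) Q r m k \<longleftrightarrow> 0 < k \<and> Q (r(i := r j)) m (k - 1)"
  unfolding wp_def by (fastforce intro: exec.intros elim: exec_CopyE)

lemma wp_Add [simp]:
  "wp B (Add i j l) Q r m k \<longleftrightarrow> r j + r l \<le> B \<and> 0 < k \<and> Q (r(i := r j + r l)) m (k - 1)"
  unfolding wp_def by (fastforce intro: exec.intros elim: exec_AddE)

lemma wp_Sub [simp]:
  "wp B (Sub i j l) Q r m k \<longleftrightarrow> 0 < k \<and> Q (r(i := r j - r l)) m (k - 1)"
  unfolding wp_def by (fastforce intro: exec.intros elim: exec_SubE)

lemma wp_Load [simp]:
  "wp B (Load i j) Q r m k \<longleftrightarrow> 0 < k \<and> Q (r(i := m (r j))) m (k - 1)"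
  unfolding wp_def by (fastforce intro: exec.intros elim: exec_LoadE)

lemma wp_Store [simp]:
  "wp B (Store i j) Q r m k \<longleftrightarrow> 0 < k \<and> Q r (m(r i := r j)) (k - 1)"
  unfolding wp_def by (fastforce intro: exec.intros elim: exec_StoreE)

text \<open>The additional premise \<open>k' \<le> k\<close> supplies the decrease for induction
  over the remaining budget.\<close>

lemma wp_mono:
  assumes "wp B P Q r m k" "\<And>r' m' k'. Q r' m' k' \<Longrightarrow> k' \<le> k \<Longrightarrow> Q' r' m' k'"
  shows "wp B P Q' r m k"
  using assms unfolding wp_def by (metis diff_le_self)

lemma wp_Seq [simp]: "wp B (Seq P P') Q r m k \<longleftrightarrow> wp B P (wp B P' Q) r m k"
proof
  assume "wp B (Seq P P') Q r m k"
  then obtain t r' m' where "exec B (Seq P P') (r, m) t (r', m')" "t \<le> k" "Q r' m' (k - t)"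
    by (auto simp: wp_def)
  moreover from this(1) obtain t1 t2 r1 m1 where
    "exec B P (r, m) t1 (r1, m1)" "exec B P' (r1, m1) t2 (r', m')" "t = t1 + t2"
    by (auto elim: exec_SeqE)
  ultimately show "wp B P (wp B P' Q) r m k"
    unfolding wp_def
    by (intro exI[of _ t1] exI[of _ r1] exI[of _ m1] conjI exI[of _ t2] exI[of _ r'] exI[of _ m']) auto
next
  assume "wp B P (wp B P' Q) r m k"
  then obtain t r' m' u r'' m'' where "exec B P (r, m) t (r', m')" "t \<le> k"
    "exec B P' (r', m') u (r'', m'')" "u \<le> k - t" "Q r'' m'' (k - t - u)"
    unfolding wp_def by blast
  then show "wp B (Seq P P') Q r m k"
    unfolding wp_def
    by (intro exI[of _ "t + u"] exI[of _ r''] exI[of _ m'']) (auto intro: exec.Seq)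
qed

lemma wp_If [simp]:
  "wp B (If b P P') Q r m k \<longleftrightarrow> 0 < k \<and>
    (if holds b (r, m) then wp B P Q r m (k - 1) else wp B P' Q r m (k - 1))"
proof
  assume "wp B (If b P P') Q r m k"
  then obtain t r' m' where "exec B (If b P P') (r, m) t (r', m')" "t \<le> k" "Q r' m' (k - t)"
    by (auto simp: wp_def)
  then show "0 < k \<and> (if holds b (r, m) then wp B P Q r m (k - 1) else wp B P' Q r m (k - 1))"
    unfolding wp_def by (elim exec_IfE) fastforce+
next
  assume *: "0 < k \<and> (if holds b (r, m) then wp B P Q r m (k - 1) else wp B P' Q r m (k - 1))"
  then obtain t r' m' where "exec B (if holds b (r, m) then P else P') (r, m) t (r', m')"
    "t \<le> k - 1" "Q r' m' (k - 1 - t)"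
    unfolding wp_def by (auto split: if_splits)
  with * show "wp B (If b P P') Q r m k"
    unfolding wp_def
    by (intro exI[of _ "1 + t"] exI[of _ r'] exI[of _ m'])
      (auto split: if_splits intro: exec.IfTrue[where t=t, simplified] exec.IfFalse[where t=t, simplified])
qed

lemma wp_While_falseI:
  assumes "0 < k" "\<not> holds b (r, m)" "Q r m (k - 1)"
  shows "wp B (While b P) Q r m k"
  using assms unfolding wp_def by (intro exI[of _ 1] exI[of _ r] exI[of _ m]) (auto intro: exec.WhileFalse[simplified])

lemma wp_While_trueI:
  assumes "0 < k" "holds b (r, m)" "wp B P (wp B (While b P) Q) r m (k - 1)"
  shows "wp B (While b P) Q r m k"
proof -
  obtain t r' m' u r'' m'' where
    "exec B P (r, m) t (r', m')" "t \<le> k - 1" "exec B (While b P) (r', m') u (r'', m'')"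
    "u \<le> k - 1 - t" "Q r'' m'' (k - 1 - t - u)"
    using assms(3) by (auto simp: wp_def)
  then show ?thesis
    using assms(1,2) unfolding wp_def
    by (intro exI[of _ "1 + t + u"] exI[of _ r''] exI[of _ m'']) (auto intro: exec.WhileTrue[where t=t, simplified])
qed

text \<open>Every iteration takes a step, so the remaining number of steps is a termination measure.\<close>

lemma wp_While_invI:
  assumes "I r m k"
    and "\<And>r m k. I r m k \<Longrightarrow> 0 < k"
    and "\<And>r m k. I r m k \<Longrightarrow> holds b (r, m) \<Longrightarrow> wp B P I r m (k - 1)"
    and "\<And>r m k. I r m k \<Longrightarrow> \<not> holds b (r, m) \<Longrightarrow> Q r m (k - 1)"
  shows "wp B (While b P) Q r m k"
  using assms(1)
proof (induction k arbitrary: r m rule: less_induct)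
  case (less k)
  show ?case
  proof (cases "holds b (r, m)")
    case True
    have "0 < k"
      using assms(2)[OF less.prems] .
    then have "wp B P (wp B (While b P) Q) r m (k - 1)"
      by (intro wp_mono[OF assms(3)[OF less.prems True]] less.IH) simp_all
    then show ?thesis
      by (rule wp_While_trueI[OF \<open>0 < k\<close> True])
  next
    case False
    then show ?thesis
      using assms(2,4)[OF less.prems] by (auto intro: wp_While_falseI)
  qed
qed

lemma linear_time_computableI:
  assumes "\<And>x. is_instance x \<Longrightarrow>
    wp (c * length (encode x)) P (\<lambda>r m k. is_solution x (map m [0..<r 0]))
      (\<lambda>i. if i = 0 then length (encode x) else 0)
      (\<lambda>a. if a < length (encode x) then encode x ! a else 0) (c * length (encode x))"
  shows "linear_time_computable is_instance encode is_solution"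
  unfolding linear_time_computable_def
proof (rule exI[of _ P], rule exI[of _ c], intro allI impI)
  fix x assume "is_instance x"
  then obtain t r m where
    "exec (c * length (encode x)) P (input_state (encode x)) t (r, m)"
    "t \<le> c * length (encode x)" "is_solution x (map m [0..<r 0])"
    using assms[of x] unfolding wp_def input_state_def by blast
  then show "\<exists>t s. exec (c * length (encode x)) P (input_state (encode x)) t s \<and>
      t \<le> c * length (encode x) \<and> is_solution x (output_word s)"
    by (intro exI[of _ t] exI[of _ "(r, m)"]) simp
qed

section \<open>First-fit coloring of adjacency lists\<close>

text \<open>
  For an input of length \<open>L\<close>, the cell \<open>p\<close> that holds the head of an arc also names this arc. The arcs
  with head \<open>w\<close> read so far form a linked list with null pointer \<open>0\<close>. It starts in cell \<open>3 * L + w\<close>,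
  and the cells \<open>L + p\<close> and \<open>2 * L + p\<close> hold the successor and the tail of \<open>p\<close>. When \<open>v\<close> is colored,
  \<open>Suc v\<close> marks its out-neighbors \<open>w\<close> in the cells \<open>4 * L + w\<close> and its forbidden colors \<open>i\<close> in the
  cells \<open>5 * L + i\<close>, so no mark has to be erased. The color of \<open>v\<close> goes to cell \<open>Suc v\<close>, where the
  input has been read already.

  Registers \<open>1\<close>, \<open>18\<close> hold \<open>1\<close>, \<open>0\<close>, and \<open>5\<close> to \<open>9\<close> the multiples of \<open>L\<close>. Register \<open>2\<close> is the
  reading position, \<open>3\<close> is \<open>v\<close>, \<open>4\<close> the number of vertices, \<open>10\<close> the number of colors, \<open>11\<close> the
  end of the list of \<open>v\<close>, \<open>12\<close> the mark, and \<open>13\<close> to \<open>17\<close> are temporary.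
\<close>

fun chain :: "nat \<Rightarrow> nat \<Rightarrow> (nat \<Rightarrow> nat) \<Rightarrow> nat \<Rightarrow> nat list \<Rightarrow> bool" where
  "chain L p m q [] \<longleftrightarrow> q = 0"
| "chain L p m q (u # us) \<longleftrightarrow>
     0 < q \<and> q < p \<and> m (2 * L + q) = u \<and> chain L p m (m (L + q)) us"

text \<open>A list reads only link and tail cells of arcs named below \<open>p\<close>, so later
  insertions and writes elsewhere leave it intact.\<close>

lemma chain_mono:
  assumes "chain L p m q us" "p \<le> p'"
    "\<And>i. i < p \<Longrightarrow> m' (L + i) = m (L + i)" "\<And>i. i < p \<Longrightarrow> m' (2 * L + i) = m (2 * L + i)"
  shows "chain L p' m' q us"
  using assms by (induction us arbitrary: q) auto

lemma map_upt_eq_Cons: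
  "map m [p..<l] = x # xs \<longleftrightarrow> p < l \<and> m p = x \<and> map m [Suc p..<l] = xs"
  by (cases "p < l") (auto simp: upt_conv_Cons)

text \<open>One pass both marks the out-neighbors of \<open>v\<close> and puts \<open>v\<close> in
  front of the list of each head.\<close>

definition scan_arcs :: com where
  "scan_arcs = While (Less 2 11)
     (Load 13 2;; Add 14 8 13;; Store 14 12;; Add 14 7 13;; Load 15 14;; Add 16 5 2;; Store 16 15;;
      Add 16 6 2;; Store 16 3;; Store 14 2;; Add 2 2 1)"

text \<open>An arc costs eleven instructions and a loop test. \<open>Q\<close> is an arbitrary
  continuation with reserved budget \<open>k'\<close>, so that loop rules chain with symbolic
  execution. \<open>distinct ws\<close> lets \<open>v\<close> enter each list once;
  \<open>0 < p\<close> keeps arc names apart from the null pointer.\<close>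

lemma wp_scan_arcs:
  assumes "map m [p..<L] = ws @ rest" "distinct ws" "set ws \<subseteq> {..<n}" "n < L" "0 < p" "6 * L \<le> B"
    and "r 2 = p" "r 11 = p + length ws" "r 1 = 1" "r 3 = v" "r 12 = Suc v"
    and "r 5 = L" "r 6 = 2 * L" "r 7 = 3 * L" "r 8 = 4 * L"
    and "\<And>w. w < n \<Longrightarrow> chain L p m (m (3 * L + w)) (us w)"
    and "k' + 12 * length ws + 1 \<le> k"
    and Q: "\<And>r' m' k''. \<lbrakk>r' 2 = p + length ws; \<And>i. i \<notin> {2, 13, 14, 15, 16} \<Longrightarrow> r' i = r i;
      map m' [p + length ws..<L] = rest;
      \<And>w. w < n \<Longrightarrow>
        chain L (p + length ws) m' (m' (3 * L + w)) (if w \<in> set ws then v # us w else us w);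
      \<And>w. w < n \<Longrightarrow> m' (4 * L + w) = (if w \<in> set ws then Suc v else m (4 * L + w));
      \<And>a. a < L \<or> 5 * L \<le> a \<Longrightarrow> m' a = m a; k' \<le> k''\<rbrakk> \<Longrightarrow> Q r' m' k''"
  shows "wp B scan_arcs Q r m k"
  using assms
proof (induction ws arbitrary: p r m us k)
  case Nil
  show ?case
    unfolding scan_arcs_def
  proof (rule wp_While_falseI)
    show "Q r m (k - 1)"
      using Nil.prems(1,7,16,17) by (intro Nil.prems(18)) simp_all
  qed (use Nil.prems in auto)
next
  case (Cons w ws)
  have p: "p < L" "m p = w" "map m [Suc p..<L] = ws @ rest"
    using Cons.prems(1) by (auto simp: map_upt_eq_Cons)
  have w: "w < n" "w \<notin> set ws" "set ws \<subseteq> {..<n}"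
    using Cons.prems(2,3) by auto
  let ?r = "r(13 := w, 14 := 3 * L + w, 15 := m (3 * L + w), 16 := 2 * L + p, 2 := Suc p)"
  let ?m = "m(4 * L + w := Suc v, L + p := m (3 * L + w), 2 * L + p := v, 3 * L + w := p)"
  let ?us = "\<lambda>u. if u = w then v # us w else us u"
  have bound: "p < L" "w < L"
    using p(1) w(1) Cons.prems(4) by auto
  have "wp B scan_arcs Q ?r ?m l" if "k - 12 \<le> l" for l
  proof (rule Cons.IH[where p="Suc p" and us="?us"])
    show "map ?m [Suc p..<L] = ws @ rest"
      using p(3) by (subst map_cong[of _ _ ?m m]) (auto simp: p(3))
    fix x assume x: "x < n"
    have "chain L (Suc p) ?m (m (3 * L + x)) (us x)"
      by (rule chain_mono[OF Cons.prems(16)[OF x]]) (use bound in auto)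
    then show "chain L (Suc p) ?m (?m (3 * L + x)) (?us x)"
      using x bound Cons.prems(4,5) by auto
  next
    fix r' m' k''
    assume r': "r' 2 = Suc p + length ws" "\<And>i. i \<notin> {2, 13, 14, 15, 16} \<Longrightarrow> r' i = ?r i"
      "map m' [Suc p + length ws..<L] = rest"
      and ch: "\<And>x. x < n \<Longrightarrow>
        chain L (Suc p + length ws) m' (m' (3 * L + x)) (if x \<in> set ws then v # ?us x else ?us x)"
      and st: "\<And>x. x < n \<Longrightarrow> m' (4 * L + x) = (if x \<in> set ws then Suc v else ?m (4 * L + x))"
      and fr: "\<And>a. a < L \<or> 5 * L \<le> a \<Longrightarrow> m' a = ?m a" and "k' \<le> k''"
    show "Q r' m' k''"
    proof (rule Cons.prems(18))
      show "chain L (p + length (w # ws)) m' (m' (3 * L + x))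
          (if x \<in> set (w # ws) then v # us x else us x)" if "x < n" for x
        using ch[OF that] w(2) by (auto split: if_splits)
      show "m' (4 * L + x) = (if x \<in> set (w # ws) then Suc v else m (4 * L + x))" if "x < n" for x
        using st[OF that] bound that Cons.prems(4) by auto
      show "m' a = m a" if "a < L \<or> 5 * L \<le> a" for a
        using fr[OF that] bound that by auto
    qed (use r' \<open>k' \<le> k''\<close> in auto)
  qed (use Cons.prems w that in auto)
  then have "wp B (While (Less 2 11)
      (Load 13 2;; Add 14 8 13;; Store 14 12;; Add 14 7 13;; Load 15 14;; Add 16 5 2;; Store 16 15;;
       Add 16 6 2;; Store 16 3;; Store 14 2;; Add 2 2 1)) Q ?r ?m l" if "k - 12 \<le> l" for l
    using that by (simp only: scan_arcs_def)
  then show ?case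
    unfolding scan_arcs_def using Cons.prems(6-15,17) p(2) bound
    by (intro wp_While_trueI) (simp_all add: fun_upd_twist)
qed

text \<open>Each \<open>u\<close> in the list has an arc to \<open>v\<close>; the mark
  \<open>Suc v\<close> on \<open>u\<close> shows the reverse arc. Only then is the color of
  \<open>u\<close> forbidden.\<close>

definition mark_colors :: com where
  "mark_colors = While (Less 18 15)
     (Add 16 6 15;; Load 13 16;; Add 16 8 13;; Load 17 16;;
      If (Equal 17 12) (Add 16 13 1;; Load 17 16;; Add 16 9 17;; Store 16 12) Skip;;
      Add 16 5 15;; Load 15 16)"

lemma wp_mark_colors:
  assumes "chain L p m (r 15) us" "p \<le> L" "set us \<subseteq> {..<v}" "v < L" "6 * L \<le> B"
    and "\<And>u. u < v \<Longrightarrow> m (Suc u) \<le> L"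
    and "r 18 = 0" "r 1 = 1" "r 12 = Suc v" "r 5 = L" "r 6 = 2 * L" "r 8 = 4 * L" "r 9 = 5 * L"
    and "k' + 12 * length us + 1 \<le> k"
    and Q: "\<And>r' m' k''. \<lbrakk>\<And>i. i \<notin> {13, 15, 16, 17} \<Longrightarrow> r' i = r i;
      \<And>a. a < 5 * L \<Longrightarrow> m' a = m a;
      \<And>c. m' (5 * L + c) =
        (if \<exists>u\<in>set us. m (4 * L + u) = Suc v \<and> m (Suc u) = c then Suc v else m (5 * L + c));
      k' \<le> k''\<rbrakk> \<Longrightarrow> Q r' m' k''"
  shows "wp B mark_colors Q r m k"
  using assms
proof (induction us arbitrary: r m k)
  case Nil
  show ?case
    unfolding mark_colors_def
    by (rule wp_While_falseI) (use Nil.prems in auto)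
next
  case (Cons u us)
  define q where "q = r 15"
  have q: "0 < q" "q < p" "m (2 * L + q) = u" "chain L p m (m (L + q)) us"
    using Cons.prems(1) by (auto simp: q_def)
  have u: "u < v" "set us \<subseteq> {..<v}" "m (Suc u) \<le> L"
    using Cons.prems(3,6) by auto
  define m1 where "m1 = (if m (4 * L + u) = Suc v then m(5 * L + m (Suc u) := Suc v) else m)"
  define a where "a = (if m (4 * L + u) = Suc v then m (Suc u) else m (4 * L + u))"
  have m1: "m1 b = m b" if "b < 5 * L" for b
    using that by (simp add: m1_def)
  let ?r = "r(16 := L + q, 13 := u, 17 := a, 15 := m (L + q))"
  have "wp B mark_colors Q ?r m1 l" if "k - 12 \<le> l" for l
  proof (rule Cons.IH)
    have "chain L p m1 (m (L + q)) us"
      by (rule chain_mono[OF q(4)]) (use Cons.prems(2) in \<open>auto intro!: m1\<close>)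
    then show "chain L p m1 (?r 15) us"
      by simp
    show "m1 (Suc x) \<le> L" if "x < v" for x
      using Cons.prems(4) Cons.prems(6)[OF that] that by (simp add: m1)
    fix r' m' k''
    assume r': "\<And>i. i \<notin> {13, 15, 16, 17} \<Longrightarrow> r' i = ?r i" "\<And>a. a < 5 * L \<Longrightarrow> m' a = m1 a"
      and us: "\<And>c. m' (5 * L + c) =
        (if \<exists>u\<in>set us. m1 (4 * L + u) = Suc v \<and> m1 (Suc u) = c then Suc v else m1 (5 * L + c))"
      and "k' \<le> k''"
    have *: "m1 (4 * L + x) = m (4 * L + x) \<and> m1 (Suc x) = m (Suc x)" if "x \<in> set us" for x
      using u(2) that Cons.prems(4) by (auto intro!: m1)
    have "m' (5 * L + c) = (if \<exists>u\<in>set us. m (4 * L + u) = Suc v \<and> m (Suc u) = c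
        then Suc v else m1 (5 * L + c))" for c
      unfolding us by (simp add: * cong: bex_cong)
    then show "Q r' m' k''"
      using r' \<open>k' \<le> k''\<close> by (intro Cons.prems(15)) (auto simp: m1 m1_def)
  qed (use Cons.prems u that in auto)
  moreover have "5 * L + m (Suc u) \<le> B" "4 * L + u \<le> B" "Suc u \<le> B" "L + q \<le> B" "2 * L + q \<le> B"
    using u q Cons.prems(2,4,5) by auto
  moreover have "L + q \<noteq> 5 * L + m (Suc u)"
    using q(2) Cons.prems(2,4) by simp
  ultimately show ?case
    unfolding mark_colors_def using Cons.prems(7-14) q u
    by (cases "m (4 * L + u) = Suc v"; intro wp_While_trueI)
      (simp_all add: m1_def a_def fun_upd_twist flip: q_def)
qed

definition skip_marked :: com where
  "skip_marked = While (Equal 17 12) (Add 13 13 1;; Add 16 9 13;; Load 17 16)"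

lemma wp_skip_marked:
  assumes "r 13 \<le> c" "\<And>i. r 13 \<le> i \<Longrightarrow> i < c \<Longrightarrow> m (5 * L + i) = r 12" "m (5 * L + c) \<noteq> r 12"
    and "c \<le> L" "6 * L \<le> B" "r 1 = 1" "r 9 = 5 * L" "r 17 = m (5 * L + r 13)"
    and "k' + 4 * (c - r 13) + 1 \<le> k"
    and Q: "\<And>r' k''. \<lbrakk>r' 13 = c; \<And>i. i \<notin> {13, 16, 17} \<Longrightarrow> r' i = r i; k' \<le> k''\<rbrakk> \<Longrightarrow> Q r' m k''"
  shows "wp B skip_marked Q r m k"
  using assms
proof (induction "c - r 13" arbitrary: r k)
  case 0
  then have "r 13 = c"
    by simp
  with 0 show ?case
    unfolding skip_marked_def by (intro wp_While_falseI) auto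
next
  case (Suc d)
  then have less: "r 13 < c"
    by simp
  let ?r = "r(13 := Suc (r 13), 16 := 5 * L + Suc (r 13), 17 := m (5 * L + Suc (r 13)))"
  have "wp B skip_marked Q ?r m l" if "k - 4 \<le> l" for l
    by (rule Suc.hyps(1)) (use Suc.prems Suc.hyps(2) less that in auto)
  moreover have "5 * L + Suc (r 13) \<le> B" "Suc (r 13) \<le> B"
    using less Suc.prems(4,5) by auto
  moreover have "4 < k"
    using Suc.prems(9) Suc.hyps(2) by simp
  moreover have "m (5 * L + r 13) = r 12"
    using Suc.prems(2) less by simp
  ultimately show ?case
    unfolding skip_marked_def using Suc.prems(6-9) less
    by (intro wp_While_trueI) (simp_all)
qed

text \<open>Register 12 holds \<open>Suc v\<close>, which is at once the mark, the address of the
  color of \<open>v\<close>, and the next vertex.\<close>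

definition choose_color :: com where
  "choose_color =
     (Copy 13 1;; Add 16 9 13;; Load 17 16;; skip_marked;; Store 12 13;;
      If (Less 10 13) (Copy 10 13) Skip;; Copy 3 12)"

lemma wp_choose_color:
  assumes "1 \<le> c" "\<And>i. 1 \<le> i \<Longrightarrow> i < c \<Longrightarrow> m (5 * L + i) = Suc v" "m (5 * L + c) \<noteq> Suc v"
    and "c \<le> L" "6 * L \<le> B" "r 1 = 1" "r 9 = 5 * L" "r 12 = Suc v" "k' + 4 * c + 4 \<le> k"
    and Q: "\<And>r' k''. \<lbrakk>r' 3 = Suc v; r' 10 = max (r 10) c;
      \<And>i. i \<notin> {3, 10, 13, 16, 17} \<Longrightarrow> r' i = r i; k' \<le> k''\<rbrakk> \<Longrightarrow> Q r' (m(Suc v := c)) k''"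
  shows "wp B choose_color Q r m k"
proof -
  let ?r = "r(13 := 1, 16 := 5 * L + 1, 17 := m (5 * L + 1))"
  have "wp B skip_marked (wp B (Store 12 13;; If (Less 10 13) (Copy 10 13) Skip;; Copy 3 12) Q) ?r m l"
    if "k - 3 \<le> l" for l
  proof (rule wp_skip_marked[where c = c and L = L and k' = "k' + 4"])
    fix r' k''
    assume r': "r' 13 = c" "\<And>i. i \<notin> {13, 16, 17} \<Longrightarrow> r' i = ?r i" and "k' + 4 \<le> k''"
    then show "wp B (Store 12 13;; If (Less 10 13) (Copy 10 13) Skip;; Copy 3 12) Q r' m k''"
      using assms(8) by (cases "r 10 < c"; simp; intro Q) (auto simp: max_def)
  qed (use assms(1-9) that in auto)
  then show ?thesis
    unfolding choose_color_def using assms(1,4-9) by simp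
qed

text \<open>Latest vertex first, matching linked lists that grow at the front.\<close>

fun earlier_in_neighbors :: "nat list list \<Rightarrow> nat \<Rightarrow> nat \<Rightarrow> nat list" where
  "earlier_in_neighbors A 0 w = []"
| "earlier_in_neighbors A (Suc v) w =
     (if w \<in> set (A ! v) then v # earlier_in_neighbors A v w else earlier_in_neighbors A v w)"

lemma set_earlier_in_neighbors: "set (earlier_in_neighbors A v w) = {u. u < v \<and> w \<in> set (A ! u)}"
  by (induction v) (auto simp: less_Suc_eq)

lemma length_earlier_in_neighbors:
  "length (earlier_in_neighbors A v w) = (\<Sum>u<v. if w \<in> set (A ! u) then 1 else 0)"
  by (induction v) auto

lemma length_earlier_in_neighbors_le: "length (earlier_in_neighbors A v w) \<le> v"
  by (induction v) auto

definition first_fit :: "(nat \<Rightarrow> nat \<Rightarrow> bool) \<Rightarrow> nat \<Rightarrow> (nat \<Rightarrow> nat) \<Rightarrow> bool" where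
  "first_fit E n c \<longleftrightarrow> (\<forall>v<n. 1 \<le> c v \<and> (\<forall>u<v. E v u \<longrightarrow> c u \<noteq> c v) \<and>
     (\<forall>i\<in>{1..<c v}. \<exists>u<v. E v u \<and> c u = i))"

lemma first_fit_Suc:
  assumes "first_fit E v c" "\<And>u. u < v \<Longrightarrow> d u = c u" "1 \<le> d v"
    and "d v \<notin> c ` {u. u < v \<and> E v u}" "{1..<d v} \<subseteq> c ` {u. u < v \<and> E v u}"
  shows "first_fit E (Suc v) d"
proof -
  have *: "\<exists>u<v. E v u \<and> d u = i" if "i \<in> {1..<d v}" for i
    using subsetD[OF assms(5) that] assms(2) by auto
  have new: "d u \<noteq> d v" if "u < v" "E v u" for u
    using assms(2,4) that by force
  have "\<exists>u<w. E w u \<and> d u = i" if "w < v" "i \<in> {1..<d w}" for w i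
    using assms(1,2) that unfolding first_fit_def by (metis order.strict_trans)
  with * new show ?thesis
    using assms(1-3) unfolding first_fit_def by (auto simp: less_Suc_eq)
qed

text \<open>All of \<open>{1..<c}\<close> is occupied, so \<open>c - 1\<close> is at most
  \<open>card M\<close>. This is what pays for the linear search for a color.\<close>

lemma first_missing:
  fixes M :: "nat set"
  assumes "finite M"
  obtains c where "1 \<le> c" "c \<notin> M" "{1..<c} \<subseteq> M" "c \<le> Suc (card M)"
proof -
  have "\<exists>c. 1 \<le> c \<and> c \<notin> M"
    using assms by (metis finite_nat_set_iff_bounded_le not_less_eq_eq le_add2 plus_1_eq_Suc nat_le_linear)
  define c where "c = (LEAST c. 1 \<le> c \<and> c \<notin> M)"
  have c: "1 \<le> c" "c \<notin> M"
    using LeastI_ex[OF \<open>\<exists>c. 1 \<le> c \<and> c \<notin> M\<close>] by (auto simp: c_def)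
  have sub: "{1..<c} \<subseteq> M"
  proof
    fix i assume "i \<in> {1..<c}"
    then show "i \<in> M"
      using not_less_Least[of i "\<lambda>c. 1 \<le> c \<and> c \<notin> M"] unfolding c_def by simp
  qed
  then have "c \<le> Suc (card M)"
    using card_mono[OF assms sub] by simp
  with c sub show ?thesis
    by (rule that)
qed

definition color_vertex :: com where
  "color_vertex =
     (Load 11 2;; Add 2 2 1;; Add 11 11 2;; Add 12 3 1;; scan_arcs;;
      Add 14 7 3;; Load 15 14;; mark_colors;; choose_color)"

text \<open>All marks are at most \<open>r 3\<close>, so the next mark is fresh. The last conjunct
  is a potential: 40 steps for each unread cell and for each list entry still to be visited, and 10
  for the end.\<close>

definition greedy_inv ::
    "nat list list \<Rightarrow> nat \<Rightarrow> (nat \<Rightarrow> nat) \<Rightarrow> (nat \<Rightarrow> nat) \<Rightarrow> nat \<Rightarrow> bool" where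
  "greedy_inv A L r m k \<longleftrightarrow>
     (r 1 = 1 \<and> r 4 = length A \<and> r 5 = L \<and> r 6 = 2 * L \<and> r 7 = 3 * L \<and> r 8 = 4 * L \<and>
      r 9 = 5 * L \<and> r 18 = 0) \<and>
     r 3 \<le> length A \<and> r 3 < r 2 \<and> r 2 \<le> L \<and>
     map m [r 2..<L] = concat (map (\<lambda>ws. length ws # ws) (drop (r 3) A)) \<and>
     (\<forall>w<length A. chain L (r 2) m (m (3 * L + w)) (earlier_in_neighbors A (r 3) w)) \<and>
     (\<forall>w<length A. m (4 * L + w) \<le> r 3) \<and>
     (\<forall>c. m (5 * L + c) \<le> r 3) \<and>
     (\<forall>u<r 3. m (Suc u) \<le> r 10 \<and> m (Suc u) \<le> Suc u) \<and>
     (r 10 = 0 \<or> (\<exists>u<r 3. m (Suc u) = r 10)) \<and>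
     first_fit (\<lambda>v u. u \<in> set (A ! v) \<and> v \<in> set (A ! u)) (r 3) (\<lambda>u. m (Suc u)) \<and>
     40 * (L - r 2) + 40 * (\<Sum>w = r 3..<length A. length (earlier_in_neighbors A w w)) + 10 \<le> k"

lemma wp_color_vertex:
  assumes A: "\<And>v. v < length A \<Longrightarrow> distinct (A ! v) \<and> set (A ! v) \<subseteq> {..<length A} \<and> v \<notin> set (A ! v)"
    and L: "length A < L" "6 * L \<le> B"
    and inv: "greedy_inv A L r m k" and less: "r 3 < r 4"
  shows "wp B color_vertex (greedy_inv A L) r m (k - 1)"
proof -
  define v where "v = r 3"
  define p where "p = r 2"
  define ws where "ws = A ! v"
  define us where "us = earlier_in_neighbors A v v"
  define rest where "rest = concat (map (\<lambda>ws. length ws # ws) (drop (Suc v) A))"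
  define p' where "p' = Suc p + length ws"
  define S where "S = (\<Sum>w = Suc v..<length A. length (earlier_in_neighbors A w w))"
  note defs = greedy_inv_def v_def[symmetric] p_def[symmetric]
  have reg: "r 1 = 1" "r 4 = length A" "r 5 = L" "r 6 = 2 * L" "r 7 = 3 * L" "r 8 = 4 * L"
    "r 9 = 5 * L" "r 18 = 0" "r 3 = v" "r 2 = p"
    using inv by (simp_all add: defs)
  have v: "v < length A" "v < p" "p \<le> L" "v < L"
    using inv less L(1) by (simp_all add: defs)
  have ws: "distinct ws" "set ws \<subseteq> {..<length A}" "v \<notin> set ws"
    using A[OF v(1)] by (auto simp: ws_def)
  have "map m [p..<L] = length ws # ws @ rest"
    using inv v(1) by (simp add: defs ws_def rest_def flip: Cons_nth_drop_Suc)
  then have word: "p < L" "m p = length ws" "map m [Suc p..<L] = ws @ rest"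
    by (simp_all add: map_upt_eq_Cons)
  from word(3) have "L - Suc p = length ws + length rest"
    by (metis length_append length_map length_upt)
  then have p': "p' \<le> L" "L - p = Suc (length ws + (L - p'))"
    using word(1) by (simp_all add: p'_def)
  have chain: "chain L p m (m (3 * L + w)) (earlier_in_neighbors A v w)" if "w < length A" for w
    using inv that by (simp add: defs)
  have stamp: "m (4 * L + w) \<le> v" if "w < length A" for w
    using inv that by (simp add: defs)
  have used: "m (5 * L + c) \<le> v" for c
    using inv by (simp add: defs)
  have col: "m (Suc u) \<le> r 10" "m (Suc u) \<le> Suc u" if "u < v" for u
    using inv that by (simp_all add: defs)
  have time: "40 * (length ws + (L - p')) + 40 * (length us + S) + 50 \<le> k"
    using inv v(1) p'(2) by (simp add: defs sum.atLeast_Suc_lessThan S_def us_def)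
  have us: "set us = {u. u < v \<and> v \<in> set (A ! u)}"
    by (simp add: us_def set_earlier_in_neighbors)
  define M where "M = (\<lambda>u. m (Suc u)) ` {u. u < v \<and> u \<in> set (A ! v) \<and> v \<in> set (A ! u)}"
  have "M \<subseteq> (\<lambda>u. m (Suc u)) ` set us"
    by (auto simp: M_def us)
  then have "card M \<le> card (set us)"
    by (meson List.finite_set card_image_le card_mono finite_imageI le_trans)
  also have "\<dots> \<le> length us"
    by (rule card_length)
  finally have card_M: "card M \<le> length us" .
  have "finite M"
    by (simp add: M_def)
  then obtain c where c: "1 \<le> c" "c \<notin> M" "{1..<c} \<subseteq> M" "c \<le> Suc (card M)"
    by (rule first_missing)
  have c_le: "c \<le> Suc (length us)" "c \<le> Suc v"
    using c(4) card_M length_earlier_in_neighbors_le[of A v v] by (auto simp: us_def)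
  define k1 where "k1 = 40 * (L - p') + 40 * S + 10"
  let ?r = "r(11 := length ws + Suc p, 2 := Suc p, 12 := Suc v)"
  have "wp B scan_arcs (wp B (Add 14 7 3;; Load 15 14;; mark_colors;; choose_color) (greedy_inv A L))
      ?r m l" if "k - 5 \<le> l" for l
  \<comment> \<open>The 16 steps per list entry are 12 for marking its color and 4 for the color
    search, as \<open>c \<le> Suc (length us)\<close>.\<close>
  proof (rule wp_scan_arcs[where L = L and us = "earlier_in_neighbors A v" and p = "Suc p" and
          ws = ws and rest = rest and n = "length A" and v = v and k' = "k1 + 16 * length us + 20"])
    show "chain L (Suc p) m (m (3 * L + w)) (earlier_in_neighbors A v w)" if "w < length A" for w
      by (rule chain_mono[OF chain[OF that]]) simp_all
  next
    fix r2 m2 k2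
    assume r2: "r2 2 = Suc p + length ws" "\<And>i. i \<notin> {2, 13, 14, 15, 16} \<Longrightarrow> r2 i = ?r i"
      and word2: "map m2 [Suc p + length ws..<L] = rest"
      and chain2: "\<And>w. w < length A \<Longrightarrow> chain L (Suc p + length ws) m2 (m2 (3 * L + w))
        (if w \<in> set ws then v # earlier_in_neighbors A v w else earlier_in_neighbors A v w)"
      and stamp2: "\<And>w. w < length A \<Longrightarrow> m2 (4 * L + w) = (if w \<in> set ws then Suc v else m (4 * L + w))"
      and frame2: "\<And>a. a < L \<or> 5 * L \<le> a \<Longrightarrow> m2 a = m a" and k2: "k1 + 16 * length us + 20 \<le> k2"
    let ?r2 = "r2(14 := 3 * L + v, 15 := m2 (3 * L + v))"
    have col2: "m2 (Suc u) = m (Suc u)" if "u < v" for u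
      using that v by (intro frame2) simp
    have chain_v: "chain L p' m2 (m2 (3 * L + v)) us"
      using chain2[OF v(1)] ws(3) by (simp add: us_def p'_def)
    have "wp B mark_colors (wp B choose_color (greedy_inv A L)) ?r2 m2 l" if "k2 - 2 \<le> l" for l
    proof (rule wp_mark_colors[where us = us and L = L and p = p' and v = v and
            k' = "k1 + 4 * length us + 10"])
      show "m2 (Suc u) \<le> L" if "u < v" for u
        using col2[OF that] col(2)[OF that] that v(4) by simp
    next
      fix r3 m3 k3
      assume r3: "\<And>i. i \<notin> {13, 15, 16, 17} \<Longrightarrow> r3 i = ?r2 i"
        and frame3: "\<And>a. a < 5 * L \<Longrightarrow> m3 a = m2 a"
        and used3: "\<And>c. m3 (5 * L + c) = (if \<exists>u\<in>set us. m2 (4 * L + u) = Suc v \<and> m2 (Suc u) = c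
            then Suc v else m2 (5 * L + c))"
        and k3: "k1 + 4 * length us + 10 \<le> k3"
      \<comment> \<open>Older marks are at most \<open>v\<close>, so \<open>Suc v\<close> identifies
        exactly the marks of this round.\<close>
      have used2: "m2 (5 * L + i) \<le> v" for i
        using frame2[of "5 * L + i"] used by simp
      have stamped: "m2 (4 * L + u) = Suc v \<longleftrightarrow> u \<in> set ws" if "u < v" for u
        using that v(1) stamp2[of u] stamp[of u] by auto
      have "(\<exists>u\<in>set us. m2 (4 * L + u) = Suc v \<and> m2 (Suc u) = i) \<longleftrightarrow> i \<in> M" for i
        unfolding M_def us using stamped col2 by (auto simp: ws_def)
      then have used3: "m3 (5 * L + i) = (if i \<in> M then Suc v else m2 (5 * L + i))" for i
        using used3 by simp
      show "wp B choose_color (greedy_inv A L) r3 m3 k3"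
      proof (rule wp_choose_color[where c = c and v = v and L = L and k' = k1])
        show "m3 (5 * L + i) = Suc v" if "1 \<le> i" "i < c" for i
          using c(3) that used3 by auto
        show "m3 (5 * L + c) \<noteq> Suc v"
          using c(2) used3[of c] used2[of c] by simp
        show "k1 + 4 * c + 4 \<le> k3"
          using k3 c_le(1) by simp
      next
        fix r4 k4
        assume r4: "r4 3 = Suc v" "r4 10 = max (r3 10) c"
          "\<And>i. i \<notin> {3, 10, 13, 16, 17} \<Longrightarrow> r4 i = r3 i" and k4: "k1 \<le> k4"
        let ?m = "m3(Suc v := c)"
        have reg4: "r4 1 = 1" "r4 4 = length A" "r4 5 = L" "r4 6 = 2 * L" "r4 7 = 3 * L"
          "r4 8 = 4 * L" "r4 9 = 5 * L" "r4 18 = 0" "r4 2 = p'" "r4 10 = max (r 10) c"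
          using r4 r3 r2 reg by (simp_all add: p'_def)
        \<comment> \<open>The color goes to a cell below the reading position and below
          \<open>L\<close>, so neither unread input nor a list or mark is overwritten.\<close>
        have Suc_v: "Suc v < L" "Suc v < p'"
          using v(1,2) L(1) by (simp_all add: p'_def)
        have low: "?m a = m2 a" if "Suc v < a" "a < 5 * L" for a
          using that frame3 by simp
        have "map ?m [p'..<L] = rest"
          using Suc_v word2 by (auto simp: p'_def frame3 intro!: map_cong)
        moreover have "chain L p' ?m (?m (3 * L + w)) (earlier_in_neighbors A (Suc v) w)"
          if "w < length A" for w
        proof -
          have "chain L p' m2 (m2 (3 * L + w)) (earlier_in_neighbors A (Suc v) w)"
            using chain2[OF that] by (simp add: p'_def ws_def split: if_splits)
          then have "chain L p' ?m (m2 (3 * L + w)) (earlier_in_neighbors A (Suc v) w)"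
            by (rule chain_mono[OF _ order_refl]) (use Suc_v p'(1) in \<open>simp_all add: frame3\<close>)
          moreover have "?m (3 * L + w) = m2 (3 * L + w)"
            using Suc_v that L(1) by (intro low) auto
          ultimately show ?thesis
            by (simp only:)
        qed
        moreover have "?m (4 * L + w) \<le> Suc v" if "w < length A" for w
          using low[of "4 * L + w"] Suc_v that L(1) stamp2[OF that] stamp[OF that] by auto
        moreover have "?m (5 * L + i) \<le> Suc v" for i
          using Suc_v used3[of i] used2[of i] by auto
        moreover have m_Suc: "?m (Suc u) = m (Suc u)" if "u < v" for u
          using that col2[OF that] frame3[of "Suc u"] Suc_v by simp
        have "?m (Suc u) \<le> r4 10 \<and> ?m (Suc u) \<le> Suc u" if "u < Suc v" for u
          using that col[of u] m_Suc[of u] c_le(2) by (cases "u = v") (auto simp: reg4 le_max_iff_disj)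
        moreover have "\<exists>u<Suc v. ?m (Suc u) = r4 10"
        proof (cases "r 10 \<le> c")
          case True
          then show ?thesis
            by (intro exI[of _ v]) (simp add: reg4)
        next
          case False
          then obtain u where "u < v" "m (Suc u) = r 10"
            using inv by (auto simp: defs)
          with False show ?thesis
            using m_Suc[of u] by (intro exI[of _ u]) (simp add: reg4)
        qed
        moreover have "first_fit (\<lambda>v u. u \<in> set (A ! v) \<and> v \<in> set (A ! u)) (Suc v) (\<lambda>u. ?m (Suc u))"
        proof (rule first_fit_Suc)
          show "first_fit (\<lambda>v u. u \<in> set (A ! v) \<and> v \<in> set (A ! u)) v (\<lambda>u. m (Suc u))"
            using inv by (simp add: defs)
        qed (use m_Suc c(1-3) in \<open>auto simp: M_def\<close>)
        ultimately show "greedy_inv A L r4 ?m k4"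
          unfolding greedy_inv_def r4(1) reg4(1-9)
          using v(1) Suc_v p'(1) k4 by (auto simp: rest_def k1_def S_def)
      qed (use c(1) c_le(2) v(4) L r3 r2 reg in auto)
    qed (use chain_v p' us v L r2 reg k2 that in auto)
    then show "wp B (Add 14 7 3;; Load 15 14;; mark_colors;; choose_color) (greedy_inv A L) r2 m2 k2"
      using r2(2) reg v L k2 by simp
  qed (use word ws L v reg time that in \<open>auto simp: k1_def\<close>)
  then show ?thesis
    unfolding color_vertex_def using reg word v L time p'
    by (simp add: fun_upd_twist add.commute p'_def)
qed

definition greedy_coloring :: com where
  "greedy_coloring =
     (Load 4 2;; Const 1 1;; Copy 2 1;; Copy 5 0;; Add 6 5 5;; Add 7 6 5;; Add 8 7 5;; Add 9 8 5;;
      While (Less 3 4) color_vertex;; Store 18 10;; Add 0 4 1)"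

text \<open>Double counting: an arc from \<open>u\<close> to \<open>w\<close> is visited at most
  once, namely when \<open>w\<close> is colored.\<close>

lemma sum_length_earlier_in_neighbors_le:
  "(\<Sum>w<n. length (earlier_in_neighbors A w w)) \<le> (\<Sum>u<n. length (A ! u))"
proof -
  have "(\<Sum>w<n. length (earlier_in_neighbors A w w)) \<le>
      (\<Sum>w<n. \<Sum>u<n. if w \<in> set (A ! u) then 1 else 0)"
    unfolding length_earlier_in_neighbors by (intro sum_mono sum_mono2) auto
  also have "\<dots> = (\<Sum>u<n. \<Sum>w<n. if w \<in> set (A ! u) then 1 else 0)"
    by (rule sum.swap)
  also have "\<dots> = (\<Sum>u<n. card ({..<n} \<inter> set (A ! u)))"
    by (simp add: sum.If_cases Int_def)
  also have "\<dots> \<le> (\<Sum>u<n. length (A ! u))"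
    by (intro sum_mono order_trans[OF card_mono card_length]) auto
  finally show ?thesis .
qed

lemma wp_greedy_coloring:
  assumes A: "\<And>v. v < length A \<Longrightarrow> distinct (A ! v) \<and> set (A ! v) \<subseteq> {..<length A} \<and> v \<notin> set (A ! v)"
    and L: "L = length (encode_adjacency_list A)"
    and Q: "\<And>r m k. \<lbrakk>greedy_inv A L r m k; r 3 = length A\<rbrakk> \<Longrightarrow>
      Q (r(0 := Suc (length A))) (m(0 := r 10)) (k - 3)"
  shows "wp (200 * L) greedy_coloring Q (\<lambda>i. if i = 0 then L else 0)
    (\<lambda>a. if a < L then encode_adjacency_list A ! a else 0) (200 * L)"
proof -
  let ?m = "\<lambda>a. if a < L then encode_adjacency_list A ! a else 0"
  let ?r = "(\<lambda>i. if i = 0 then L else 0)(4 := length A, 1 := 1, 2 := 1, 5 := L, 6 := L + L,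
    7 := L + L + L, 8 := L + L + L + L, 9 := L + L + L + L + L)"
  have L_eq: "L = Suc (length A + (\<Sum>u<length A. length (A ! u)))"
    by (simp add: L encode_adjacency_list_def length_concat comp_def sum_list_Suc
        sum_list_sum_nth atLeast0LessThan sum_Suc)
  then have n: "length A < L"
    by simp
  have "map ?m [0..<L] = map (nth (encode_adjacency_list A)) [0..<L]"
    by simp
  also have "\<dots> = length A # concat (map (\<lambda>ws. length ws # ws) A)"
    unfolding L map_nth by (simp add: encode_adjacency_list_def)
  finally have word: "?m 0 = length A" "map ?m [Suc 0..<L] = concat (map (\<lambda>ws. length ws # ws) A)"
    unfolding map_upt_eq_Cons by blast+
  have "wp (200 * L) (While (Less 3 4) color_vertex) (wp (200 * L) (Store 18 10;; Add 0 4 1) Q) ?r ?m l"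
    if "200 * L - 8 \<le> l" for l
  proof (rule wp_While_invI)
    \<comment> \<open>Unread cells and list entries number at most \<open>L - 1\<close> each, so
      about \<open>80 * L\<close> steps suffice.\<close>
    have "40 * (L - 1) + 40 * (\<Sum>w<length A. length (earlier_in_neighbors A w w)) + 10 \<le> l"
      using sum_length_earlier_in_neighbors_le[where n = "length A" and A = A] L_eq that by simp
    then show "greedy_inv A L ?r ?m l"
      using word(2) n by (simp add: greedy_inv_def first_fit_def atLeast0LessThan)
  next
    fix r m k assume inv: "greedy_inv A L r m k"
    then show "0 < k"
      by (simp add: greedy_inv_def)
    show "wp (200 * L) color_vertex (greedy_inv A L) r m (k - 1)" if "holds (Less 3 4) (r, m)"
      using that n by (intro wp_color_vertex[OF A _ _ inv]) auto
    show "wp (200 * L) (Store 18 10;; Add 0 4 1) Q r m (k - 1)" if "\<not> holds (Less 3 4) (r, m)"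
    proof -
      have r: "r 3 = length A" "r 18 = 0" "r 4 = length A" "r 1 = 1" "10 \<le> k"
        using inv that by (auto simp: greedy_inv_def)
      then show ?thesis
        using Q[OF inv r(1)] n by (simp add: numeral_3_eq_3)
    qed
  qed
  then show ?thesis
    unfolding greedy_coloring_def using word(1) n by (simp add: fun_upd_twist)
qed

text \<open>Symmetry of mutual adjacency turns first fit into the Grundy property. The colors fill
  \<open>{1..r}\<close> because a vertex of color \<open>r\<close> sees all smaller ones.\<close>

lemma optimal_output_if_first_fit:
  assumes G: "ext_directed_cograph G" "pverts G = {..<n}"
    and fit: "first_fit (mutual G) n c"
    and max: "\<And>u. u < n \<Longrightarrow> c u \<le> r" "r = 0 \<or> (\<exists>u<n. c u = r)"
  shows "is_optimal_coloring_output G (r # map c [0..<n])"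
proof -
  have sym: "mutual G u v \<longleftrightarrow> mutual G v u" for u v
    by (auto simp: mutual_def)
  have pos: "1 \<le> c v" and proper: "\<And>u. u < v \<Longrightarrow> mutual G v u \<Longrightarrow> c u \<noteq> c v"
    and small: "\<And>i. 1 \<le> i \<Longrightarrow> i < c v \<Longrightarrow> \<exists>u<v. mutual G v u \<and> c u = i" if "v < n" for v
    using fit that by (auto simp: first_fit_def)
  have "mutual_proper G c"
    unfolding mutual_proper_def
  proof (intro allI impI)
    fix u v assume uv: "mutual G u v"
    then have "u < n" "v < n" "u \<noteq> v"
      using mutual_verts[OF G(1) uv] G(2) by auto
    then show "c u \<noteq> c v"
      using proper[of v u] proper[of u v] uv sym[of u v] by (metis linorder_neqE_nat)
  qed
  moreover have "\<exists>u. mutual G u v \<and> c u = i" if "v < n" "i \<in> c ` {..<n}" "i < c v" for v i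
    using small[OF that(1), of i] pos that(2,3) sym[of v] by blast
  ultimately have "grundy G c"
    unfolding grundy_def by (simp add: G(2))
  moreover have "c ` pverts G = {1..r}"
  proof (intro equalityI subsetI)
    fix i assume "i \<in> c ` pverts G"
    then show "i \<in> {1..r}"
      using pos max(1) by (auto simp: G(2))
  next
    fix i assume i: "i \<in> {1..r}"
    then obtain v where v: "v < n" "c v = r"
      using max(2) by auto
    show "i \<in> c ` pverts G"
    proof (cases "i = r")
      case True
      with v show ?thesis
        by (auto simp: G(2))
    next
      case False
      then obtain u where "u < v" "c u = i"
        using small[OF v(1), of i] i v(2) by auto
      with v(1) show ?thesis
        by (auto simp: G(2))
    qed
  qed
  ultimately have "dichromatic_number G = r" "acyclic_coloring G r c"
    using optimal_coloring_if_grundy[OF G(1)] by blast+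
  then show ?thesis
    unfolding is_optimal_coloring_output_def by (intro exI[of _ c]) (simp add: G(2))
qed

lemma first_fit_cong:
  "(\<And>v u. v < n \<Longrightarrow> u < v \<Longrightarrow> E v u = F v u) \<Longrightarrow> first_fit E n c = first_fit F n c"
  unfolding first_fit_def by (simp cong: conj_cong)

lemma linear_time_directed_cograph:
  "linear_time_computable
     (\<lambda>(G, A). directed_cograph G \<and> is_adjacency_list A G)
     (\<lambda>(G, A). encode_adjacency_list A)
     (\<lambda>(G, A). is_optimal_coloring_output G)"
proof (rule linear_time_computableI[where c = 200 and P = greedy_coloring], clarify)
  fix G A assume "directed_cograph G" and adj: "is_adjacency_list A G"
  then have G: "ext_directed_cograph G"
    by (simp add: directed_cograph_imp_ext_directed_cograph)
  have V: "pverts G = {..<length A}"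
    and N: "\<And>v. v < length A \<Longrightarrow> distinct (A ! v) \<and> set (A ! v) = {w. (v, w) \<in> parcs G}"
    using adj by (auto simp: is_adjacency_list_def)
  have arcs: "v < length A \<and> w < length A \<and> v \<noteq> w" if "(v, w) \<in> parcs G" for v w
    using ext_directed_cograph_arcD[OF G that] V by auto
  define L where "L = length (encode_adjacency_list A)"
  have "wp (200 * L) greedy_coloring (\<lambda>r m k. is_optimal_coloring_output G (map m [0..<r 0]))
      (\<lambda>i. if i = 0 then L else 0) (\<lambda>a. if a < L then encode_adjacency_list A ! a else 0) (200 * L)"
  proof (rule wp_greedy_coloring)
    show "distinct (A ! v) \<and> set (A ! v) \<subseteq> {..<length A} \<and> v \<notin> set (A ! v)" if "v < length A" for v
      using N[OF that] arcs by auto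
    show "L = length (encode_adjacency_list A)"
      by (fact L_def)
    fix r m k assume inv: "greedy_inv A L r m k" and r: "r 3 = length A"
    have "first_fit (mutual G) (length A) (\<lambda>u. m (Suc u))"
      using inv r first_fit_cong[of "length A" "\<lambda>v u. u \<in> set (A ! v) \<and> v \<in> set (A ! u)" "mutual G"] N
      by (auto simp: greedy_inv_def mutual_def)
    then have "is_optimal_coloring_output G (r 10 # map (\<lambda>u. m (Suc u)) [0..<length A])"
      using inv r by (intro optimal_output_if_first_fit[OF G V]) (auto simp: greedy_inv_def)
    moreover have "map (m(0 := r 10)) [0..<Suc (length A)] = r 10 # map (\<lambda>u. m (Suc u)) [0..<length A]"
      by (simp add: upt_conv_Cons flip: map_Suc_upt del: upt_Suc)
    ultimately show "is_optimal_coloring_output G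
        (map (m(0 := r 10)) [0..<(r(0 := Suc (length A))) 0])"
      by simp
  qed
  then show "wp (200 * length (encode_adjacency_list A)) greedy_coloring
      (\<lambda>r m k. is_optimal_coloring_output G (map m [0..<r 0]))
      (\<lambda>i. if i = 0 then length (encode_adjacency_list A) else 0)
      (\<lambda>a. if a < length (encode_adjacency_list A) then encode_adjacency_list A ! a else 0)
      (200 * length (encode_adjacency_list A))"
    by (simp only: L_def)
qed

section \<open>Coloring along an ex-di-co-tree\<close>

text \<open>
  Registers \<open>1\<close>, \<open>3\<close>, \<open>4\<close>, \<open>14\<close> hold \<open>1\<close>, \<open>2\<close>, \<open>3\<close>, \<open>0\<close>. Register \<open>2\<close> is the reading position, \<open>5\<close> the
  number of colors to shift by, \<open>6\<close> the top frame of the stack, \<open>7\<close> the number of colors of the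
  subtree just finished, and \<open>8\<close> is \<open>0\<close> when reading, \<open>1\<close> when returning, \<open>2\<close> at the end.
  A frame is a pair of cells: the tag \<open>1\<close> or \<open>2\<close> with the shift while the left child of a directed
  union or a series composition is traversed, then \<open>3\<close> or \<open>4\<close> with the number of colors of the
  left child. The fresh cells at the bottom of the stack serve as a sentinel with tag \<open>0\<close>.
  The colors are collected from the cell in register \<open>9\<close> onwards, since the vertices come in any
  order while the input is still needed.
\<close>

definition read_token :: com where
  "read_token =
     (Load 10 2;; Add 2 2 1;;
      If (Equal 10 14)
        (Load 11 2;; Add 2 2 1;; Add 12 9 11;; Add 7 5 1;; Store 12 7;; Copy 7 1;; Copy 8 1)
        (Add 6 6 3;; Store 6 10;; Add 12 6 1;; Store 12 5))"

text \<open>Tests compare registers: \<open>Equal 10 1\<close>, \<open>Equal 10 3\<close> and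
  \<open>Equal 10 4\<close> ask for the tags 1, 2 and 3, and tag 4 remains. Entering the right child
  adds 2 to the tag.\<close>

definition return_from_subtree :: com where
  "return_from_subtree =
     (Load 10 6;; Add 12 6 1;; Load 11 12;;
      If (Equal 10 14) (Copy 8 3)
     (If (Equal 10 1) (Store 6 4;; Store 12 7;; Copy 5 11;; Copy 8 14)
     (If (Equal 10 3) (Add 13 4 1;; Store 6 13;; Store 12 7;; Add 5 11 7;; Copy 8 14)
     (If (Equal 10 4) (Sub 6 6 3;; If (Less 7 11) (Copy 7 11) Skip)
     (Sub 6 6 3;; Add 7 7 11)))))"

definition color_tree :: com where
  "color_tree = While (Less 8 3) (If (Equal 8 14) read_token return_from_subtree)"

section \<open>Single iterations of the traversal loop\<close>

definition tree_regs :: "nat \<Rightarrow> (nat \<Rightarrow> nat) \<Rightarrow> bool" where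
  "tree_regs L r \<longleftrightarrow> r 1 = 1 \<and> r 3 = 2 \<and> r 4 = 3 \<and> r 9 = 4 * L \<and> r 14 = 0"

text \<open>An iteration takes fewer than 20 steps. The 60 steps per input symbol come from the
  three iterations of an inner node: push, switch to the right child, pop.\<close>

lemma wp_color_tree_leaf:
  assumes "tree_regs L r" "r 8 = 0" "m (r 2) = 0" "m (Suc (r 2)) = v"
    and "r 2 < L" "v < L" "r 5 < L" "6 * L \<le> B" "2 \<le> L"
    and "60 * 2 + k' \<le> k"
    and "\<And>r' l. \<lbrakk>\<And>i. i \<notin> {2, 7, 8, 10, 11, 12} \<Longrightarrow> r' i = r i; r' 2 = r 2 + 2; r' 7 = 1; r' 8 = 1;
      k' \<le> l\<rbrakk> \<Longrightarrow> wp B color_tree Q r' (m(4 * L + v := Suc (r 5))) l"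
  shows "wp B color_tree Q r m k"
proof -
  have "wp B color_tree Q (r(10 := 0, 2 := Suc (Suc (r 2)), 11 := v, 12 := 4 * L + v, 7 := 1, 8 := 1))
      (m(4 * L + v := Suc (r 5))) l" if "k - 20 \<le> l" for l
    by (rule assms(11)) (use that assms(10) in auto)
  then show ?thesis
    using assms(1-10) unfolding color_tree_def tree_regs_def
    by (intro wp_While_trueI) (simp_all add: read_token_def fun_upd_twist)
qed

lemma wp_color_tree_push:
  assumes "tree_regs L r" "r 8 = 0" "m (r 2) = tag" "tag \<noteq> 0"
    and "r 2 < L" "r 6 \<le> 3 * L" "6 * L \<le> B" "2 \<le> L"
    and "20 + k' \<le> k"
    and "\<And>r' l. \<lbrakk>\<And>i. i \<notin> {2, 6, 10, 12} \<Longrightarrow> r' i = r i; r' 2 = Suc (r 2); r' 6 = r 6 + 2; k' \<le> l\<rbrakk> \<Longrightarrow>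
      wp B color_tree Q r' (m(r 6 + 2 := tag, r 6 + 3 := r 5)) l"
  shows "wp B color_tree Q r m k"
proof -
  have "wp B color_tree Q (r(10 := tag, 2 := Suc (r 2), 6 := r 6 + 2, 12 := r 6 + 3))
      (m(r 6 + 2 := tag, r 6 + 3 := r 5)) l" if "k - 20 \<le> l" for l
    by (rule assms(10)) (use that assms(9) in auto)
  then show ?thesis
    using assms(1-9) unfolding color_tree_def tree_regs_def
    by (intro wp_While_trueI) (simp_all add: read_token_def fun_upd_twist numeral_3_eq_3)
qed

lemma wp_color_tree_left:
  assumes "tree_regs L r" "r 8 = 1" "r 6 = sp" "m sp = tag" "tag \<in> {1, 2}" "m (Suc sp) = off"
    and "sp \<le> 3 * L" "off + r 7 \<le> L" "6 * L \<le> B" "2 \<le> L"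
    and "20 + k' \<le> k"
    and "\<And>r' l. \<lbrakk>\<And>i. i \<notin> {5, 8, 10, 11, 12, 13} \<Longrightarrow> r' i = r i;
      r' 5 = (if tag = 1 then off else off + r 7); r' 8 = 0; k' \<le> l\<rbrakk> \<Longrightarrow>
      wp B color_tree Q r' (m(sp := tag + 2, Suc sp := r 7)) l"
  shows "wp B color_tree Q r m k"
proof (cases "tag = 1")
  case True
  have "wp B color_tree Q (r(10 := 1, 12 := Suc sp, 11 := off, 5 := off, 8 := 0))
      (m(sp := tag + 2, Suc sp := r 7)) l" if "k - 20 \<le> l" for l
    by (rule assms(12)) (use that True assms(11) in auto)
  then show ?thesis
    using True assms(1-11) unfolding color_tree_def tree_regs_def
    by (intro wp_While_trueI) (simp_all add: return_from_subtree_def fun_upd_twist numeral_3_eq_3)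
next
  case False
  have "wp B color_tree Q (r(10 := 2, 12 := Suc sp, 11 := off, 13 := 4, 5 := off + r 7, 8 := 0))
      (m(sp := tag + 2, Suc sp := r 7)) l" if "k - 20 \<le> l" for l
    by (rule assms(12)) (use that False assms(11) in auto)
  then show ?thesis
    using False assms(1-11) unfolding color_tree_def tree_regs_def
    by (intro wp_While_trueI) (simp_all add: return_from_subtree_def fun_upd_twist)
qed

lemma wp_color_tree_right:
  assumes "tree_regs L r" "r 8 = 1" "r 6 = sp + 2" "m (sp + 2) = tag" "tag \<in> {3, 4}" "m (sp + 3) = x"
    and "sp \<le> 3 * L" "r 7 + x \<le> L" "6 * L \<le> B" "2 \<le> L"
    and "20 + k' \<le> k"
    and "\<And>r' l. \<lbrakk>\<And>i. i \<notin> {6, 7, 10, 11, 12} \<Longrightarrow> r' i = r i;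
      r' 7 = (if tag = 3 then max x (r 7) else x + r 7); r' 6 = sp; k' \<le> l\<rbrakk> \<Longrightarrow>
      wp B color_tree Q r' m l"
  shows "wp B color_tree Q r m k"
proof (cases "tag = 3")
  case True
  have "wp B color_tree Q (r(10 := 3, 12 := sp + 3, 11 := x, 6 := sp, 7 := max x (r 7))) m l"
    if "k - 20 \<le> l" for l
    by (rule assms(12)) (use that True assms(11) in auto)
  moreover have "r(10 := 3, 12 := sp + 3, 11 := x, 6 := sp, 7 := max x (r 7)) =
      r(10 := 3, 12 := sp + 3, 11 := x, 6 := sp)" if "\<not> r 7 < x"
    using that by (auto simp: max_def)
  ultimately show ?thesis
    using True assms(1-11) unfolding color_tree_def tree_regs_def
    by (cases "r 7 < x"; intro wp_While_trueI)
      (simp_all add: return_from_subtree_def fun_upd_twist numeral_3_eq_3)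
next
  case False
  have "wp B color_tree Q (r(10 := 4, 12 := sp + 3, 11 := x, 6 := sp, 7 := x + r 7)) m l"
    if "k - 20 \<le> l" for l
    by (rule assms(12)) (use that False assms(11) in auto)
  then show ?thesis
    using False assms(1-11) unfolding color_tree_def tree_regs_def
    by (intro wp_While_trueI)
      (simp_all add: return_from_subtree_def fun_upd_twist numeral_3_eq_3 add.commute)
qed

text \<open>Keeps shifts, and hence all colors, within the length of the input.\<close>

lemma cotree_number_le_length: "cotree_number T \<le> length (encode_cotree T)"
  by (induction T) auto

lemma map_upt_cong: "(\<And>a. p \<le> a \<Longrightarrow> a < l \<Longrightarrow> m' a = m a) \<Longrightarrow> map m' [p..<l] = map m [p..<l]"
  by (auto intro: map_cong)

lemma length_if_map_upt: "map m [p..<l] = xs @ ys \<Longrightarrow> xs \<noteq> [] \<Longrightarrow> p + length xs \<le> l"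
  by (drule arg_cong[of _ _ length]) (cases xs; simp)

lemma encode_cotree_neq_Nil [simp]: "encode_cotree T \<noteq> []"
  by (cases T) auto

text \<open>
  This is in continuation-passing style, because a single loop traverses all subtrees: the loop may
  start reading the tree \<open>w\<close> if it works for every state in which it has just returned from \<open>w\<close>.
\<close>

definition traverses ::
    "nat \<Rightarrow> nat \<Rightarrow> nat list \<Rightarrow> nat set \<Rightarrow> nat \<Rightarrow> (nat \<Rightarrow> nat) \<Rightarrow> bool" where
  "traverses B L w V x f \<longleftrightarrow>
    (\<forall>r m k p rest off sp k' Q.
      tree_regs L r \<and> map m [p..<L] = w @ rest \<and> r 2 = p \<and> r 5 = off \<and> r 6 = sp \<and> r 8 = 0 \<and>
      off \<le> p \<and> L \<le> sp \<and> sp \<le> L + 2 * p \<and> 60 * length w + k' \<le> k \<and>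
      (\<forall>r' m' l.
        (\<forall>i. i \<notin> {2, 5, 6, 7, 8, 10, 11, 12, 13} \<longrightarrow> r' i = r i) \<and>
        r' 2 = p + length w \<and> r' 6 = sp \<and> r' 7 = x \<and> r' 8 = 1 \<and>
        (\<forall>a < sp + 2. m' a = m a) \<and>
        (\<forall>v. m' (4 * L + v) = (if v \<in> V then off + f v else m (4 * L + v))) \<and> k' \<le> l
        \<longrightarrow> wp B color_tree Q r' m' l)
      \<longrightarrow> wp B color_tree Q r m k)"

lemma wp_if_traverses:
  assumes "traverses B L w V x f"
    and "tree_regs L r" "map m [p..<L] = w @ rest" "r 2 = p" "r 5 = off" "r 6 = sp" "r 8 = 0"
    and "off \<le> p" "L \<le> sp" "sp \<le> L + 2 * p" "60 * length w + k' \<le> k"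
    and "\<And>r' m' l. \<lbrakk>\<And>i. i \<notin> {2, 5, 6, 7, 8, 10, 11, 12, 13} \<Longrightarrow> r' i = r i;
      r' 2 = p + length w; r' 6 = sp; r' 7 = x; r' 8 = 1; \<And>a. a < sp + 2 \<Longrightarrow> m' a = m a;
      \<And>v. m' (4 * L + v) = (if v \<in> V then off + f v else m (4 * L + v)); k' \<le> l\<rbrakk> \<Longrightarrow>
      wp B color_tree Q r' m' l"
  shows "wp B color_tree Q r m k"
  using assms(1)[unfolded traverses_def, rule_format, of r m p rest off sp k' k Q] assms(2-)
  by blast

lemma traverses_leaf:
  assumes "2 \<le> L" "6 * L \<le> B" "v < L"
  shows "traverses B L [0, v] {v} 1 (\<lambda>_. 1)"
  unfolding traverses_def
proof (intro allI impI, elim conjE)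
  fix r m k p rest off sp k' Q
  assume regs: "tree_regs L r" and "map m [p..<L] = [0, v] @ rest"
    and r: "r 2 = p" "r 5 = off" "r 6 = sp" "r 8 = 0" and b: "off \<le> p" "L \<le> sp" "sp \<le> L + 2 * p"
    and k: "60 * length [0, v] + k' \<le> k"
    and Q: "\<forall>r' m' l.
        (\<forall>i. i \<notin> {2, 5, 6, 7, 8, 10, 11, 12, 13} \<longrightarrow> r' i = r i) \<and>
        r' 2 = p + length [0, v] \<and> r' 6 = sp \<and> r' 7 = 1 \<and> r' 8 = 1 \<and>
        (\<forall>a < sp + 2. m' a = m a) \<and>
        (\<forall>u. m' (4 * L + u) = (if u \<in> {v} then off + 1 else m (4 * L + u))) \<and> k' \<le> l
        \<longrightarrow> wp B color_tree Q r' m' l"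
  then have word: "p < L" "m p = 0" "Suc p < L" "m (Suc p) = v"
    by (auto simp: map_upt_eq_Cons)
  show "wp B color_tree Q r m k"
  proof (rule wp_color_tree_leaf[where L = L and v = v and k' = k'])
    fix r' l
    assume "\<And>i. i \<notin> {2, 7, 8, 10, 11, 12} \<Longrightarrow> r' i = r i" "r' 2 = r 2 + 2" "r' 7 = 1" "r' 8 = 1" "k' \<le> l"
    then show "wp B color_tree Q r' (m(4 * L + v := Suc (r 5))) l"
      using b r word by (intro Q[rule_format]) simp
  qed (use assms regs r b k word in auto)
qed

text \<open>Each symbol read accounts for at most one color and one frame of two cells, whence
  \<open>off \<le> p\<close> and \<open>sp \<le> L + 2 * p\<close>. The traversal of the left child
  is continued by that of the right.\<close>

lemma traverses_node:
  assumes S: "traverses B L w V x f" and T: "traverses B L w' V' x' f'"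
    and "V \<inter> V' = {}" "x \<le> length w" "x' \<le> length w'" "w' \<noteq> []"
    and L: "2 \<le> L" "6 * L \<le> B" and tag: "tag \<in> {1, 2}"
  shows "traverses B L (tag # w @ w') (V \<union> V') (if tag = 1 then max x x' else x + x')
    (\<lambda>v. if v \<in> V then f v else if tag = 1 then f' v else x + f' v)"
    (is "traverses B L ?w ?V ?x ?f")
  unfolding traverses_def
proof (intro allI impI, elim conjE)
  fix r m k p rest off sp k' Q
  assume regs: "tree_regs L r" and map: "map m [p..<L] = ?w @ rest"
    and r: "r 2 = p" "r 5 = off" "r 6 = sp" "r 8 = 0" and b: "off \<le> p" "L \<le> sp" "sp \<le> L + 2 * p"
    and k: "60 * length ?w + k' \<le> k"
    and Q: "\<forall>r' m' l.
        (\<forall>i. i \<notin> {2, 5, 6, 7, 8, 10, 11, 12, 13} \<longrightarrow> r' i = r i) \<and>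
        r' 2 = p + length ?w \<and> r' 6 = sp \<and> r' 7 = ?x \<and> r' 8 = 1 \<and>
        (\<forall>a < sp + 2. m' a = m a) \<and>
        (\<forall>v. m' (4 * L + v) = (if v \<in> ?V then off + ?f v else m (4 * L + v))) \<and> k' \<le> l
        \<longrightarrow> wp B color_tree Q r' m' l"
  from map have word: "p < L" "m p = tag" "map m [Suc p..<L] = w @ w' @ rest"
    by (auto simp: map_upt_eq_Cons)
  have len: "Suc p + length w + length w' \<le> L"
    using length_if_map_upt[of m p L ?w rest] map by simp
  define off' where "off' = (if tag = 1 then off else off + x)"
  have off': "off' \<le> Suc p + length w"
    using b(1) assms(4) by (simp add: off'_def)
  show "wp B color_tree Q r m k"
  \<comment> \<open>Of the 60 steps for the tag, the push takes 20; the switch and the pop keep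
    40.\<close>
  proof (rule wp_color_tree_push[where L = L and tag = tag and
        k' = "60 * length w + (60 * length w' + (40 + k'))"])
    fix r1 l1
    assume r1: "\<And>i. i \<notin> {2, 6, 10, 12} \<Longrightarrow> r1 i = r i" "r1 2 = Suc (r 2)" "r1 6 = r 6 + 2"
      and l1: "60 * length w + (60 * length w' + (40 + k')) \<le> l1"
    let ?m1 = "m(r 6 + 2 := tag, r 6 + 3 := r 5)"
    show "wp B color_tree Q r1 ?m1 l1"
    proof (rule wp_if_traverses[OF S _ _ _ _ _ _ _ _ _ l1, where p = "Suc p" and off = off and
          sp = "sp + 2" and rest = "w' @ rest"])
      show "tree_regs L r1"
        using regs r1(1) by (simp add: tree_regs_def)
      show "map ?m1 [Suc p..<L] = w @ w' @ rest"
        unfolding word(3)[symmetric] using b(2) r by (intro map_upt_cong) simp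
    next
      fix r2 m2 l2
      assume r2: "\<And>i. i \<notin> {2, 5, 6, 7, 8, 10, 11, 12, 13} \<Longrightarrow> r2 i = r1 i"
          "r2 2 = Suc p + length w" "r2 6 = sp + 2" "r2 7 = x" "r2 8 = 1"
        and m2: "\<And>a. a < sp + 2 + 2 \<Longrightarrow> m2 a = ?m1 a"
          "\<And>v. m2 (4 * L + v) = (if v \<in> V then off + f v else ?m1 (4 * L + v))"
        and l2: "60 * length w' + (40 + k') \<le> l2"
      have regs2: "tree_regs L r2"
        using regs r1(1) r2(1) by (simp add: tree_regs_def)
      show "wp B color_tree Q r2 m2 l2"
      proof (rule wp_color_tree_left[where L = L and sp = "sp + 2" and tag = tag and off = off and
            k' = "60 * length w' + (20 + k')"])
        show "m2 (sp + 2) = tag" "m2 (Suc (sp + 2)) = off"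
          using m2(1)[of "sp + 2"] m2(1)[of "sp + 3"] r by (simp_all add: numeral_3_eq_3)
      next
        fix r3 l3
        assume r3: "\<And>i. i \<notin> {5, 8, 10, 11, 12, 13} \<Longrightarrow> r3 i = r2 i"
            "r3 5 = (if tag = 1 then off else off + r2 7)" "r3 8 = 0"
          and l3: "60 * length w' + (20 + k') \<le> l3"
        let ?m3 = "m2(sp + 2 := tag + 2, Suc (sp + 2) := r2 7)"
        show "wp B color_tree Q r3 ?m3 l3"
        proof (rule wp_if_traverses[OF T _ _ _ _ _ _ _ _ _ l3, where p = "Suc p + length w" and
              off = off' and sp = "sp + 2" and rest = rest])
          show "tree_regs L r3"
            using regs2 r3(1) by (simp add: tree_regs_def)
          have "map ?m3 [Suc p + length w..<L] = map m [Suc p + length w..<L]"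
            using b(2) r m2(1) by (intro map_upt_cong) simp
          also have "\<dots> = drop (length w) (map m [Suc p..<L])"
            by (simp add: drop_map)
          finally show "map ?m3 [Suc p + length w..<L] = w' @ rest"
            unfolding word(3) by simp
        next
          fix r4 m4 l4
          assume r4: "\<And>i. i \<notin> {2, 5, 6, 7, 8, 10, 11, 12, 13} \<Longrightarrow> r4 i = r3 i"
              "r4 2 = Suc p + length w + length w'" "r4 6 = sp + 2" "r4 7 = x'" "r4 8 = 1"
            and m4: "\<And>a. a < sp + 2 + 2 \<Longrightarrow> m4 a = ?m3 a"
              "\<And>v. m4 (4 * L + v) = (if v \<in> V' then off' + f' v else ?m3 (4 * L + v))"
            and l4: "20 + k' \<le> l4"
          have regs4: "tree_regs L r4"
            using regs2 r3(1) r4(1) by (simp add: tree_regs_def)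
          show "wp B color_tree Q r4 m4 l4"
          proof (rule wp_color_tree_right[where L = L and sp = sp and tag = "tag + 2" and x = x and
                k' = k'])
            show "m4 (sp + 2) = tag + 2" "m4 (sp + 3) = x"
              using m4(1)[of "sp + 2"] m4(1)[of "sp + 3"] r2 by (simp_all add: numeral_3_eq_3)
          next
            fix r5 l5
            assume r5: "\<And>i. i \<notin> {6, 7, 10, 11, 12} \<Longrightarrow> r5 i = r4 i"
                "r5 7 = (if tag + 2 = 3 then max x (r4 7) else x + r4 7)" "r5 6 = sp"
              and l5: "k' \<le> l5"
            have "m4 a = m a" if "a < sp + 2" for a
              using that m4(1)[of a] m2(1)[of a] r by simp
            moreover have "m4 (4 * L + v) = (if v \<in> ?V then off + ?f v else m (4 * L + v))" for v
            proof -
              \<comment> \<open>The new frame ends below the color cells, so writing it changes no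
                color.\<close>
              have "sp + 3 < 4 * L"
                using b(3) word(1) len \<open>w' \<noteq> []\<close> by (cases w') auto
              then have "m4 (4 * L + v) = (if v \<in> V' then off' + f' v
                  else if v \<in> V then off + f v else m (4 * L + v))"
                using m4(2)[of v] m2(2)[of v] r by auto
              then show ?thesis
                using assms(3) tag by (auto simp: off'_def)
            qed
            ultimately show "wp B color_tree Q r5 m4 l5"
              using r5 r4 r3 r2 r1 l5 by (intro Q[rule_format]) auto
          qed (use regs4 r4 L l4 tag b word(1) len assms(4,5) in auto)
        qed (use r3 r2 r1 r off' b len in \<open>auto simp: off'_def\<close>)
      qed (use regs2 r2 L l2 tag b word(1) len assms(4,5) in auto)
    qed (use r1 r b in auto)
  qed (use regs r word(1,2) b k L tag in auto)
qed

lemma traverses_cotree: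
  assumes "ex_di_cotree T G" "2 \<le> L" "6 * L \<le> B" "set_cotree T \<subseteq> {..<L}"
  shows "traverses B L (encode_cotree T) (set_cotree T) (cotree_number T) (cotree_color T)"
  using assms
proof (induction rule: ex_di_cotree.induct)
  case (leaf v)
  then show ?case
    using traverses_leaf[of L B v] by simp
next
  case (dunion S G T H D)
  then have "set_cotree S \<inter> set_cotree T = {}"
    by (simp add: pverts_cotree)
  then show ?case
    using dunion traverses_node[of B L "encode_cotree S" "set_cotree S" "cotree_number S"
        "cotree_color S" "encode_cotree T" "set_cotree T" "cotree_number T" "cotree_color T" 1]
    by (simp add: cotree_number_le_length cong: if_cong)
next
  case (series S G T H)
  then have "set_cotree S \<inter> set_cotree T = {}"
    by (simp add: pverts_cotree)
  then show ?case
    using series traverses_node[of B L "encode_cotree S" "set_cotree S" "cotree_number S"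
        "cotree_color S" "encode_cotree T" "set_cotree T" "cotree_number T" "cotree_color T" 2]
    by (simp add: cotree_number_le_length cong: if_cong)
qed

text \<open>A tree does not announce its number of vertices. As colors are positive, the first zero
  cell from \<open>4 * L\<close> on marks the end.\<close>

definition copy_colors :: com where
  "copy_colors = While (Less 14 10) (Add 2 2 1;; Store 2 10;; Add 12 9 2;; Load 10 12)"

lemma wp_copy_colors:
  assumes "r 1 = 1" "r 9 = 4 * L" "r 14 = 0" "r 2 = i" "r 10 = m (4 * L + i)"
    and "\<And>j. j < n \<Longrightarrow> 0 < m (4 * L + j)" "m (4 * L + n) = 0"
    and "i \<le> n" "n < L" "6 * L \<le> B" "5 * (n - i) + 1 + k' \<le> k"
    and "\<And>r' m' l. \<lbrakk>\<And>i. i \<notin> {2, 10, 12} \<Longrightarrow> r' i = r i; r' 2 = n; m' 0 = m 0;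
      \<And>j. j < n \<Longrightarrow> m' (Suc j) = (if i \<le> j then m (4 * L + j) else m (Suc j)); k' \<le> l\<rbrakk> \<Longrightarrow> Q r' m' l"
  shows "wp B copy_colors Q r m k"
  using assms
proof (induction "n - i" arbitrary: i r m k)
  case 0
  then have "i = n"
    by simp
  with 0 show ?case
    unfolding copy_colors_def by (intro wp_While_falseI) auto
next
  case (Suc d)
  have i: "i < n"
    using Suc.hyps(2) by simp
  let ?r = "r(2 := Suc i, 12 := 4 * L + Suc i, 10 := m (4 * L + Suc i))"
  let ?m = "m(Suc i := m (4 * L + i))"
  have "wp B copy_colors Q ?r ?m l" if "k - 5 \<le> l" for l
  proof (rule Suc.hyps(1))
    fix r' m' l
    assume r': "\<And>i. i \<notin> {2, 10, 12} \<Longrightarrow> r' i = ?r i" "r' 2 = n" "m' 0 = ?m 0" "k' \<le> l"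
      and m': "\<And>j. j < n \<Longrightarrow> m' (Suc j) = (if Suc i \<le> j then ?m (4 * L + j) else ?m (Suc j))"
    show "Q r' m' l"
    proof (rule Suc.prems(12))
      show "m' (Suc j) = (if i \<le> j then m (4 * L + j) else m (Suc j))" if "j < n" for j
        using m'[OF that] i Suc.prems(9) by (auto simp: not_less_eq_eq le_Suc_eq)
    qed (use r' in auto)
  qed (use Suc.prems(1-11) Suc.hyps(2) i that in auto)
  moreover have "4 < k"
    using Suc.prems(11) i by simp
  ultimately show ?case
    unfolding copy_colors_def using Suc.prems(1-5,9,10) Suc.prems(6)[OF i] i
    by (intro wp_While_trueI) (simp_all add: fun_upd_twist)
qed

text \<open>Registers 2, 5, 8 and 14 start correctly at zero: position, shift, reading mode and the
  constant 0.\<close>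

definition cotree_coloring :: com where
  "cotree_coloring =
     (Const 1 1;; Add 3 1 1;; Add 4 3 1;; Copy 6 0;; Add 9 0 0;; Add 9 9 9;; color_tree;;
      Copy 2 14;; Add 12 9 2;; Load 10 12;; Store 14 7;; copy_colors;; Add 0 2 1)"

lemma wp_color_tree_stop:
  assumes "tree_regs L r" "r 8 = 1" "m (r 6) = 0" "r 6 < B" "k' + 10 \<le> k"
    and "\<And>r' l. \<lbrakk>\<And>i. i \<notin> {8, 10, 11, 12} \<Longrightarrow> r' i = r i; k' \<le> l\<rbrakk> \<Longrightarrow> Q r' m l"
  shows "wp B color_tree Q r m k"
proof -
  have "Q (r(10 := 0, 12 := Suc (r 6), 11 := m (Suc (r 6)), 8 := 2)) m l" if "k - 10 \<le> l" for l
    by (rule assms(6)) (use that assms(5) in auto)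
  then have "wp B color_tree Q (r(10 := 0, 12 := Suc (r 6), 11 := m (Suc (r 6)), 8 := 2)) m l"
    if "k - 9 \<le> l" for l
    using assms(1,5) that unfolding color_tree_def tree_regs_def
    by (intro wp_While_falseI) auto
  then show ?thesis
    using assms(1-5) unfolding color_tree_def tree_regs_def
    by (intro wp_While_trueI) (simp_all add: return_from_subtree_def fun_upd_twist)
qed

lemma wp_cotree_coloring:
  assumes T: "ex_di_cotree T G" "set_cotree T = {..<n}"
    and w: "w = encode_cotree T" "L = length w" and n: "0 < n" "n < L"
    and Q: "\<And>r m k. \<lbrakk>r 0 = Suc n; m 0 = cotree_number T; \<And>v. v < n \<Longrightarrow> m (Suc v) = cotree_color T v\<rbrakk> \<Longrightarrow> Q r m k"
  shows "wp (200 * L) cotree_coloring Q (\<lambda>i. if i = 0 then L else 0)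
    (\<lambda>a. if a < L then w ! a else 0) (200 * L)"
proof -
  let ?m = "\<lambda>a. if a < L then w ! a else 0"
  let ?r = "(\<lambda>i. if i = 0 then L else 0)(1 := 1, 3 := 2, 4 := 3, 6 := L, 9 := 4 * L)"
  let ?finish = "Copy 2 14;; Add 12 9 2;; Load 10 12;; Store 14 7;; copy_colors;; Add 0 2 1"
  have L: "2 \<le> L"
    using n by simp
  have "map ?m [0..<L] = map (nth w) [0..<L]"
    by simp
  then have word: "map ?m [0..<L] = encode_cotree T @ []"
    by (simp add: w map_nth)
  have "wp (200 * L) color_tree (wp (200 * L) ?finish Q) ?r ?m l" if "200 * L - 6 \<le> l" for l
  \<comment> \<open>The stack pointer starts at \<open>L\<close>, whose zero cell is the sentinel.
    Beyond 60 steps per symbol, \<open>130 * L\<close> remain for stopping and copying.\<close>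
  proof (rule wp_if_traverses[OF traverses_cotree[OF T(1)], where L = L and p = 0 and off = 0 and
        sp = L and rest = "[]" and k' = "130 * L"])
    fix r m :: "nat \<Rightarrow> nat" and l
    assume r: "\<And>i. i \<notin> {2, 5, 6, 7, 8, 10, 11, 12, 13} \<Longrightarrow> r i = ?r i"
        "r 6 = L" "r 7 = cotree_number T" "r 8 = 1"
      and m: "\<And>a. a < L + 2 \<Longrightarrow> m a = ?m a"
        "\<And>v. m (4 * L + v) = (if v \<in> set_cotree T then 0 + cotree_color T v else ?m (4 * L + v))"
      and l: "130 * L \<le> l"
    have color: "0 < m (4 * L + v)" "m (4 * L + v) = cotree_color T v" if "v < n" for v
      using m(2)[of v] that T(2) cotree_color_bounds[of v T] by auto
    have end_color: "m (4 * L + n) = 0"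
      using m(2)[of n] T(2) by simp
    show "wp (200 * L) color_tree (wp (200 * L) ?finish Q) r m l"
    proof (rule wp_color_tree_stop[where L = L and k' = "120 * L"])
      fix r' :: "nat \<Rightarrow> nat" and l'
      assume r': "\<And>i. i \<notin> {8, 10, 11, 12} \<Longrightarrow> r' i = r i" and l': "120 * L \<le> l'"
      let ?r' = "r'(2 := 0, 12 := 4 * L, 10 := m (4 * L))"
      have "wp (200 * L) copy_colors (wp (200 * L) (Add 0 2 1) Q) ?r' (m(0 := cotree_number T)) l''"
        if "l' - 5 \<le> l''" for l''
      proof (rule wp_copy_colors[where L = L and i = 0 and n = n and k' = 1])
        fix r2 m2 :: "nat \<Rightarrow> nat" and l2 :: nat
        assume "\<And>i. i \<notin> {2, 10, 12} \<Longrightarrow> r2 i = ?r' i" "r2 2 = n" "m2 0 = (m(0 := cotree_number T)) 0"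
          "1 \<le> l2" and m2: "\<And>j. j < n \<Longrightarrow> m2 (Suc j) = (if 0 \<le> j then (m(0 := cotree_number T)) (4 * L + j)
              else (m(0 := cotree_number T)) (Suc j))"
        moreover have "m2 (Suc v) = cotree_color T v" if "v < n" for v
          using m2[OF that] color[OF that] L by simp
        ultimately show "wp (200 * L) (Add 0 2 1) Q r2 m2 l2"
          using r r' n by (auto intro: Q)
      qed (use r r' color end_color n L l' that in auto)
      then show "wp (200 * L) ?finish Q r' m l'"
        using r r' n l' by (simp add: fun_upd_twist)
    qed (use r m l L in \<open>auto simp: tree_regs_def\<close>)
  qed (use word L T(2) n w(2) w(1) that in \<open>auto simp: tree_regs_def\<close>)
  moreover have "4 * L = L + L + (L + L)"
    by simp
  ultimately show ?thesis
    unfolding cotree_coloring_def using L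
    by (simp add: fun_upd_twist numeral_2_eq_2 numeral_3_eq_3)
qed

lemma linear_time_cotree:
  "linear_time_computable
     (\<lambda>(G, T). ext_directed_cograph G \<and> pverts G = {..<card (pverts G)} \<and> ex_di_cotree T G)
     (\<lambda>(G, T). encode_cotree T)
     (\<lambda>(G, T). is_optimal_coloring_output G)"
proof (rule linear_time_computableI[where c = 200 and P = cotree_coloring], clarify)
  fix G T assume V: "pverts G = {..<card (pverts G)}" and T: "ex_di_cotree T G"
  define n where "n = card (pverts G)"
  have V: "pverts G = {..<n}"
    using V by (simp add: n_def)
  have set_T: "set_cotree T = {..<n}"
    using pverts_cotree[OF T] V by simp
  have "length (encode_cotree T) + 1 = 3 * n"
    using length_encode_cotree[OF T] by (simp add: n_def)
  then have n: "0 < n" "n < length (encode_cotree T)"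
    by (cases n; simp)+
  show "wp (200 * length (encode_cotree T)) cotree_coloring
      (\<lambda>r m k. is_optimal_coloring_output G (map m [0..<r 0]))
      (\<lambda>i. if i = 0 then length (encode_cotree T) else 0)
      (\<lambda>a. if a < length (encode_cotree T) then encode_cotree T ! a else 0)
      (200 * length (encode_cotree T))"
  proof (rule wp_cotree_coloring[OF T set_T refl refl n])
    fix r m :: "nat \<Rightarrow> nat"
    assume "r 0 = Suc n" "m 0 = cotree_number T" "\<And>v. v < n \<Longrightarrow> m (Suc v) = cotree_color T v"
    then have "map m [0..<r 0] = cotree_number T # map (cotree_color T) [0..<n]"
      by (simp add: upt_conv_Cons flip: map_Suc_upt del: upt_Suc)
    then show "is_optimal_coloring_output G (map m [0..<r 0])"
      using optimal_cotree_color[OF T] unfolding is_optimal_coloring_output_def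
      by (intro exI[of _ "cotree_color T"]) (simp add: V)
  qed
qed

theorem theorem3p9:
  shows "linear_time_computable
           (\<lambda>(G, A). directed_cograph G \<and> is_adjacency_list A G)
           (\<lambda>(G, A). encode_adjacency_list A)
           (\<lambda>(G, A). is_optimal_coloring_output G)
    \<and> linear_time_computable
           (\<lambda>(G, T). ext_directed_cograph G \<and> pverts G = {..<card (pverts G)} \<and> ex_di_cotree T G)
           (\<lambda>(G, T). encode_cotree T)
           (\<lambda>(G, T). is_optimal_coloring_output G)"
  using linear_time_directed_cograph linear_time_cotree ..

end
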